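(* Let $\mathcal{A}$ be any abelian category and let $\mathcal{F}_1\subset\mathcal{F}_2\subset\mathcal{G}$ be a filtration of an object $\mathcal{G}$ of $\mathcal{A}$ by subobjects, yielding the exact sequence $$0\longrightarrow \mathcal{F}_1\longrightarrow \mathcal{F}_2\stackrel{f}{\longrightarrow}\mathcal{G}/\mathcal{F}_1\longrightarrow \mathcal{G}/\mathcal{F}_2\longrightarrow 0,$$ where $f$ is the composition of the embedding $\mathcal{F}_2\to\mathcal{G}$ with the canonical surjection $\mathcal{G}\to\mathcal{G}/\mathcal{F}_1$. Let $\alpha\in \mathrm{Ext}^2_{\mathcal{A}}(\mathcal{G}/\mathcal{F}_2,\mathcal{F}_1)\simeq \mathrm{Hom}_{D(\mathcal{A})}(\mathcal{G}/\mathcal{F}_2,\mathcal{F}_1[2])$ be the class corresponding to this exact sequence. Then $\alpha=0$.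
   Context: $D(\mathcal{A})$ is the derived category of $\mathcal{A}$ (the localization of the homotopy category of cochain complexes at quasi-isomorphisms), $[i]$ is the $i$-fold shift, and $\mathcal{A}$ is regarded as the full subcategory of $D(\mathcal{A})$ of complexes concentrated in degree $0$. One identifies $\mathrm{Ext}^i_{\mathcal{A}}(A,B)$ with $\mathrm{Hom}_{D(\mathcal{A})}(A,B[i])$. Class of an exact sequence (Yoneda's construction): the exact sequence $0\to B\to E_i\to\cdots\to E_1\to C\to 0$ in $\mathcal{A}$ corresponds to the morphism $C\to B[i]$ in $D(\mathcal{A})$ represented by the roof $C\stackrel{s}{\longleftarrow}\tilde{\mathcal{L}}^\bullet\stackrel{g}{\longrightarrow}B[i]$. Here $\tilde{\mathcal{L}}^\bullet$ is the complex $B\to E_i\to\cdots\to E_1$ with $E_1$ in degree $0$ and $B$ in degree $-i$. The map $s$ is the quasi-isomorphism given by $E_1\to C$ in degree $0$ and zero in other degrees. The map $g$ is the identity of $B$ in degree $-i$ and zero in other degrees. *)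

theory Defs
  imports "HOL-Algebra.Group"
begin

section \<open>Categories\<close>

record ('o, 'm) cat =
  obj :: "'o set"
  arr :: "'m set"
  Dom :: "'m \<Rightarrow> 'o"
  Cod :: "'m \<Rightarrow> 'o"
  ident :: "'o \<Rightarrow> 'm"
  comp :: "'m \<Rightarrow> 'm \<Rightarrow> 'm"  (infixl "\<cdot>\<index>" 70)

definition Hom :: "('o, 'm, 'c) cat_scheme \<Rightarrow> 'o \<Rightarrow> 'o \<Rightarrow> 'm set" where
  "Hom C X Y = {f \<in> arr C. Dom C f = X \<and> Cod C f = Y}"

locale category =
  fixes C :: "('o, 'm, 'c) cat_scheme" (structure)
  assumes Dom_obj: "f \<in> arr C \<Longrightarrow> Dom C f \<in> obj C"
    and Cod_obj: "f \<in> arr C \<Longrightarrow> Cod C f \<in> obj C"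
    and ident_Hom: "X \<in> obj C \<Longrightarrow> ident C X \<in> Hom C X X"
    and comp_Hom: "\<lbrakk>f \<in> Hom C X Y; g \<in> Hom C Y Z\<rbrakk> \<Longrightarrow> g \<cdot> f \<in> Hom C X Z"
    and comp_ident_right: "f \<in> Hom C X Y \<Longrightarrow> f \<cdot> ident C X = f"
    and comp_ident_left: "f \<in> Hom C X Y \<Longrightarrow> ident C Y \<cdot> f = f"
    and comp_assoc: "\<lbrakk>f \<in> Hom C X Y; g \<in> Hom C Y Z; h \<in> Hom C Z W\<rbrakk> \<Longrightarrow>
      (h \<cdot> g) \<cdot> f = h \<cdot> (g \<cdot> f)"

definition monic :: "('o, 'm, 'c) cat_scheme \<Rightarrow> 'm \<Rightarrow> bool" where
  "monic C m \<longleftrightarrow> m \<in> arr C \<and>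
     (\<forall>W. \<forall>u \<in> Hom C W (Dom C m). \<forall>v \<in> Hom C W (Dom C m).
        m \<cdot>\<^bsub>C\<^esub> u = m \<cdot>\<^bsub>C\<^esub> v \<longrightarrow> u = v)"

definition epic :: "('o, 'm, 'c) cat_scheme \<Rightarrow> 'm \<Rightarrow> bool" where
  "epic C e \<longleftrightarrow> e \<in> arr C \<and>
     (\<forall>W. \<forall>u \<in> Hom C (Cod C e) W. \<forall>v \<in> Hom C (Cod C e) W.
        u \<cdot>\<^bsub>C\<^esub> e = v \<cdot>\<^bsub>C\<^esub> e \<longrightarrow> u = v)"

definition iso_arr :: "('o, 'm, 'c) cat_scheme \<Rightarrow> 'm \<Rightarrow> bool" where
  "iso_arr C f \<longleftrightarrow> f \<in> arr C \<and>
     (\<exists>g \<in> Hom C (Cod C f) (Dom C f).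
        g \<cdot>\<^bsub>C\<^esub> f = ident C (Dom C f) \<and> f \<cdot>\<^bsub>C\<^esub> g = ident C (Cod C f))"

definition zero_object :: "('o, 'm, 'c) cat_scheme \<Rightarrow> 'o \<Rightarrow> bool" where
  "zero_object C Z \<longleftrightarrow> Z \<in> obj C \<and>
     (\<forall>X \<in> obj C. (\<exists>!f. f \<in> Hom C X Z) \<and> (\<exists>!f. f \<in> Hom C Z X))"

section \<open>Abelian categories\<close>

record ('o, 'm) precat = "('o, 'm) cat" +
  hplus :: "'m \<Rightarrow> 'm \<Rightarrow> 'm"  (infixl "\<oplus>\<index>" 65)
  hzero :: "'o \<Rightarrow> 'o \<Rightarrow> 'm"

definition hom_group :: "('o, 'm, 'c) precat_scheme \<Rightarrow> 'o \<Rightarrow> 'o \<Rightarrow> 'm monoid" where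
  "hom_group A X Y = \<lparr>carrier = Hom A X Y, mult = hplus A, one = hzero A X Y\<rparr>"

locale preadditive_category = category A for A :: "('o, 'm, 'c) precat_scheme" (structure) +
  assumes hom_comm_group: "\<lbrakk>X \<in> obj A; Y \<in> obj A\<rbrakk> \<Longrightarrow> comm_group (hom_group A X Y)"
    and comp_hplus_right: "\<lbrakk>f \<in> Hom A X Y; g \<in> Hom A X Y; h \<in> Hom A Y Z\<rbrakk> \<Longrightarrow>
      h \<cdot> (f \<oplus> g) = (h \<cdot> f) \<oplus> (h \<cdot> g)"
    and comp_hplus_left: "\<lbrakk>f \<in> Hom A X Y; g \<in> Hom A Y Z; h \<in> Hom A Y Z\<rbrakk> \<Longrightarrow>
      (g \<oplus> h) \<cdot> f = (g \<cdot> f) \<oplus> (h \<cdot> f)"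

definition is_kernel :: "('o, 'm, 'c) precat_scheme \<Rightarrow> 'm \<Rightarrow> 'm \<Rightarrow> bool" where
  "is_kernel A f k \<longleftrightarrow> f \<in> arr A \<and> k \<in> Hom A (Dom A k) (Dom A f) \<and>
     f \<cdot>\<^bsub>A\<^esub> k = hzero A (Dom A k) (Cod A f) \<and>
     (\<forall>W. \<forall>t \<in> Hom A W (Dom A f). f \<cdot>\<^bsub>A\<^esub> t = hzero A W (Cod A f) \<longrightarrow>
        (\<exists>!u. u \<in> Hom A W (Dom A k) \<and> k \<cdot>\<^bsub>A\<^esub> u = t))"

definition is_cokernel :: "('o, 'm, 'c) precat_scheme \<Rightarrow> 'm \<Rightarrow> 'm \<Rightarrow> bool" where
  "is_cokernel A f p \<longleftrightarrow> f \<in> arr A \<and> p \<in> Hom A (Cod A f) (Cod A p) \<and>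
     p \<cdot>\<^bsub>A\<^esub> f = hzero A (Dom A f) (Cod A p) \<and>
     (\<forall>W. \<forall>t \<in> Hom A (Cod A f) W. t \<cdot>\<^bsub>A\<^esub> f = hzero A (Dom A f) W \<longrightarrow>
        (\<exists>!u. u \<in> Hom A (Cod A p) W \<and> u \<cdot>\<^bsub>A\<^esub> p = t))"

definition is_biproduct ::
  "('o, 'm, 'c) precat_scheme \<Rightarrow> 'o \<Rightarrow> 'o \<Rightarrow> 'o \<Rightarrow> 'm \<Rightarrow> 'm \<Rightarrow> 'm \<Rightarrow> 'm \<Rightarrow> bool" where
  "is_biproduct A X Y S a b p q \<longleftrightarrow>
     a \<in> Hom A X S \<and> b \<in> Hom A Y S \<and> p \<in> Hom A S X \<and> q \<in> Hom A S Y \<and>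
     p \<cdot>\<^bsub>A\<^esub> a = ident A X \<and> q \<cdot>\<^bsub>A\<^esub> b = ident A Y \<and>
     q \<cdot>\<^bsub>A\<^esub> a = hzero A X Y \<and> p \<cdot>\<^bsub>A\<^esub> b = hzero A Y X \<and>
     (a \<cdot>\<^bsub>A\<^esub> p) \<oplus>\<^bsub>A\<^esub> (b \<cdot>\<^bsub>A\<^esub> q) = ident A S"

locale abelian_category = preadditive_category A
  for A :: "('o, 'm, 'c) precat_scheme" (structure) +
  assumes ex_zero_object: "\<exists>Z. zero_object A Z"
    and ex_biproduct: "\<lbrakk>X \<in> obj A; Y \<in> obj A\<rbrakk> \<Longrightarrow> \<exists>S a b p q. is_biproduct A X Y S a b p q"
    and ex_kernel: "f \<in> arr A \<Longrightarrow> \<exists>k. is_kernel A f k"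
    and ex_cokernel: "f \<in> arr A \<Longrightarrow> \<exists>p. is_cokernel A f p"
    and monic_is_kernel: "monic A m \<Longrightarrow> \<exists>f. is_kernel A f m"
    and epic_is_cokernel: "epic A e \<Longrightarrow> \<exists>f. is_cokernel A f e"

definition zero_ob :: "('o, 'm, 'c) precat_scheme \<Rightarrow> 'o" where
  "zero_ob A = (SOME Z. zero_object A Z)"

definition Ker :: "('o, 'm, 'c) precat_scheme \<Rightarrow> 'm \<Rightarrow> 'm" where
  "Ker A f = (SOME k. is_kernel A f k)"

definition Coker :: "('o, 'm, 'c) precat_scheme \<Rightarrow> 'm \<Rightarrow> 'm" where
  "Coker A f = (SOME p. is_cokernel A f p)"

definition Im :: "('o, 'm, 'c) precat_scheme \<Rightarrow> 'm \<Rightarrow> 'm" where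
  "Im A f = Ker A (Coker A f)"

definition exact_at :: "('o, 'm, 'c) precat_scheme \<Rightarrow> 'm \<Rightarrow> 'm \<Rightarrow> bool" where
  "exact_at A f g \<longleftrightarrow> f \<in> arr A \<and> g \<in> arr A \<and> Cod A f = Dom A g \<and> is_kernel A g (Im A f)"

text \<open>
  An exact sequence \<open>0 \<rightarrow> B \<rightarrow> E\<^sub>i \<rightarrow> \<dots> \<rightarrow> E\<^sub>1 \<rightarrow> C \<rightarrow> 0\<close> is given by its arrows, numbered from the
  right: \<open>e 0 : E\<^sub>1 \<rightarrow> C\<close>, \<open>e k : E\<^sub>k\<^sub>+\<^sub>1 \<rightarrow> E\<^sub>k\<close> for \<open>0 < k < i\<close>, and \<open>e i : B \<rightarrow> E\<^sub>i\<close>.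
\<close>

definition exact_seq :: "('o, 'm, 'c) precat_scheme \<Rightarrow> nat \<Rightarrow> (nat \<Rightarrow> 'm) \<Rightarrow> bool" where
  "exact_seq A i e \<longleftrightarrow>
     exact_at A (hzero A (zero_ob A) (Dom A (e i))) (e i) \<and>
     (\<forall>k<i. exact_at A (e (Suc k)) (e k)) \<and>
     exact_at A (e 0) (hzero A (Cod A (e 0)) (zero_ob A))"

section \<open>Cochain complexes and cohomology\<close>

record ('o, 'm) complex =
  ob :: "int \<Rightarrow> 'o"
  diff :: "int \<Rightarrow> 'm"

definition is_complex :: "('o, 'm, 'c) precat_scheme \<Rightarrow> ('o, 'm) complex \<Rightarrow> bool" where
  "is_complex A X \<longleftrightarrow>
     (\<forall>n. ob X n \<in> obj A) \<and>
     (\<forall>n. diff X n \<in> Hom A (ob X n) (ob X (n + 1))) \<and>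
     (\<forall>n. diff X (n + 1) \<cdot>\<^bsub>A\<^esub> diff X n = hzero A (ob X n) (ob X (n + 1 + 1)))"

definition chain_map ::
  "('o, 'm, 'c) precat_scheme \<Rightarrow> ('o, 'm) complex \<Rightarrow> ('o, 'm) complex \<Rightarrow> (int \<Rightarrow> 'm) \<Rightarrow> bool" where
  "chain_map A X Y f \<longleftrightarrow>
     (\<forall>n. f n \<in> Hom A (ob X n) (ob Y n)) \<and>
     (\<forall>n. f (n + 1) \<cdot>\<^bsub>A\<^esub> diff X n = diff Y n \<cdot>\<^bsub>A\<^esub> f n)"

definition homotopic ::
  "('o, 'm, 'c) precat_scheme \<Rightarrow> ('o, 'm) complex \<Rightarrow> ('o, 'm) complex \<Rightarrow>
     (int \<Rightarrow> 'm) \<Rightarrow> (int \<Rightarrow> 'm) \<Rightarrow> bool" where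
  "homotopic A X Y f g \<longleftrightarrow>
     (\<exists>h. (\<forall>n. h n \<in> Hom A (ob X n) (ob Y (n - 1))) \<and>
          (\<forall>n. f n = g n \<oplus>\<^bsub>A\<^esub>
             ((diff Y (n - 1) \<cdot>\<^bsub>A\<^esub> h n) \<oplus>\<^bsub>A\<^esub> (h (n + 1) \<cdot>\<^bsub>A\<^esub> diff X n))))"

text \<open>
  \<open>H\<^sup>n(X)\<close> is the cokernel of the map \<open>X\<^sup>n\<^sup>-\<^sup>1 \<rightarrow> Z\<^sup>n(X)\<close> through which the differential factors,
  where \<open>Z\<^sup>n(X)\<close> is the kernel of \<open>X\<^sup>n \<rightarrow> X\<^sup>n\<^sup>+\<^sup>1\<close>.
\<close>

definition cocyc :: "('o, 'm, 'c) precat_scheme \<Rightarrow> ('o, 'm) complex \<Rightarrow> int \<Rightarrow> 'm" where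
  "cocyc A X n = Ker A (diff X n)"

definition bd_lift :: "('o, 'm, 'c) precat_scheme \<Rightarrow> ('o, 'm) complex \<Rightarrow> int \<Rightarrow> 'm" where
  "bd_lift A X n =
     (THE u. u \<in> Hom A (ob X (n - 1)) (Dom A (cocyc A X n)) \<and>
             cocyc A X n \<cdot>\<^bsub>A\<^esub> u = diff X (n - 1))"

definition coh_proj :: "('o, 'm, 'c) precat_scheme \<Rightarrow> ('o, 'm) complex \<Rightarrow> int \<Rightarrow> 'm" where
  "coh_proj A X n = Coker A (bd_lift A X n)"

definition coh :: "('o, 'm, 'c) precat_scheme \<Rightarrow> ('o, 'm) complex \<Rightarrow> int \<Rightarrow> 'o" where
  "coh A X n = Cod A (coh_proj A X n)"

definition cocyc_map ::
  "('o, 'm, 'c) precat_scheme \<Rightarrow> ('o, 'm) complex \<Rightarrow> ('o, 'm) complex \<Rightarrow> (int \<Rightarrow> 'm) \<Rightarrow>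
     int \<Rightarrow> 'm" where
  "cocyc_map A X Y f n =
     (THE z. z \<in> Hom A (Dom A (cocyc A X n)) (Dom A (cocyc A Y n)) \<and>
             cocyc A Y n \<cdot>\<^bsub>A\<^esub> z = f n \<cdot>\<^bsub>A\<^esub> cocyc A X n)"

definition coh_map ::
  "('o, 'm, 'c) precat_scheme \<Rightarrow> ('o, 'm) complex \<Rightarrow> ('o, 'm) complex \<Rightarrow> (int \<Rightarrow> 'm) \<Rightarrow>
     int \<Rightarrow> 'm" where
  "coh_map A X Y f n =
     (THE \<phi>. \<phi> \<in> Hom A (coh A X n) (coh A Y n) \<and>
             \<phi> \<cdot>\<^bsub>A\<^esub> coh_proj A X n = coh_proj A Y n \<cdot>\<^bsub>A\<^esub> cocyc_map A X Y f n)"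

definition quasi_iso ::
  "('o, 'm, 'c) precat_scheme \<Rightarrow> ('o, 'm) complex \<Rightarrow> ('o, 'm) complex \<Rightarrow> (int \<Rightarrow> 'm) \<Rightarrow> bool" where
  "quasi_iso A X Y f \<longleftrightarrow> chain_map A X Y f \<and> (\<forall>n. iso_arr A (coh_map A X Y f n))"

section \<open>The homotopy category\<close>

type_synonym ('o, 'm) harrow = "('o, 'm) complex \<times> ('o, 'm) complex \<times> (int \<Rightarrow> 'm) set"

definition hclass ::
  "('o, 'm, 'c) precat_scheme \<Rightarrow> ('o, 'm) complex \<Rightarrow> ('o, 'm) complex \<Rightarrow> (int \<Rightarrow> 'm) \<Rightarrow>
     ('o, 'm) harrow" where
  "hclass A X Y f = (X, Y, {g. chain_map A X Y g \<and> homotopic A X Y f g})"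

definition homotopy_category ::
  "('o, 'm, 'c) precat_scheme \<Rightarrow> (('o, 'm) complex, ('o, 'm) harrow) cat" where
  "homotopy_category A =
     \<lparr>obj = {X. is_complex A X},
      arr = {hclass A X Y f | X Y f. is_complex A X \<and> is_complex A Y \<and> chain_map A X Y f},
      Dom = (\<lambda>(X, Y, a). X),
      Cod = (\<lambda>(X, Y, a). Y),
      ident = (\<lambda>X. hclass A X X (\<lambda>n. ident A (ob X n))),
      comp = (\<lambda>(Y', Z, b) (X, Y, a).
        (X, Z, \<Union>f\<in>a. \<Union>g\<in>b. snd (snd (hclass A X Z (\<lambda>n. g n \<cdot>\<^bsub>A\<^esub> f n)))))\<rparr>"

definition quasi_isos :: "('o, 'm, 'c) precat_scheme \<Rightarrow> ('o, 'm) harrow set" where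
  "quasi_isos A =
     {hclass A X Y f | X Y f. is_complex A X \<and> is_complex A Y \<and> quasi_iso A X Y f}"

section \<open>Localization of a category\<close>

text \<open>
  The localization of \<open>C\<close> at \<open>W\<close> has the objects of \<open>C\<close>; its arrows are the paths made of arrows of
  \<open>C\<close> and formal inverses of arrows in \<open>W\<close>, modulo the congruence that makes \<open>C\<close> map functorially
  and the formal inverses inverse to the arrows in \<open>W\<close>. Paths are written in the order in which
  they are traversed, so the roof with legs \<open>s : L \<rightarrow> X\<close> in \<open>W\<close> and \<open>g : L \<rightarrow> Y\<close> is
  \<open>[Bwd s, Fwd g]\<close>, from \<open>X\<close> to \<open>Y\<close>.
\<close>

datatype 'm step = Fwd 'm | Bwd 'm

fun is_path :: "('o, 'm, 'c) cat_scheme \<Rightarrow> 'm set \<Rightarrow> 'o \<Rightarrow> 'm step list \<Rightarrow> 'o \<Rightarrow> bool" where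
  "is_path C W X [] Y \<longleftrightarrow> X \<in> obj C \<and> X = Y"
| "is_path C W X (Fwd f # p) Y \<longleftrightarrow> f \<in> arr C \<and> Dom C f = X \<and> is_path C W (Cod C f) p Y"
| "is_path C W X (Bwd w # p) Y \<longleftrightarrow> w \<in> W \<and> w \<in> arr C \<and> Cod C w = X \<and> is_path C W (Dom C w) p Y"

inductive loc_eq ::
  "('o, 'm, 'c) cat_scheme \<Rightarrow> 'm set \<Rightarrow> 'o \<Rightarrow> 'o \<Rightarrow> 'm step list \<Rightarrow> 'm step list \<Rightarrow> bool"
  for C W X Y where
  refl: "is_path C W X p Y \<Longrightarrow> loc_eq C W X Y p p"
| sym: "loc_eq C W X Y p q \<Longrightarrow> loc_eq C W X Y q p"
| trans: "loc_eq C W X Y p q \<Longrightarrow> loc_eq C W X Y q r \<Longrightarrow> loc_eq C W X Y p r"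
| ident: "Z \<in> obj C \<Longrightarrow> is_path C W X (p @ [Fwd (ident C Z)] @ q) Y \<Longrightarrow>
    loc_eq C W X Y (p @ [Fwd (ident C Z)] @ q) (p @ q)"
| comp: "is_path C W X (p @ [Fwd f, Fwd g] @ q) Y \<Longrightarrow>
    loc_eq C W X Y (p @ [Fwd f, Fwd g] @ q) (p @ [Fwd (g \<cdot>\<^bsub>C\<^esub> f)] @ q)"
| fwd_bwd: "is_path C W X (p @ [Fwd w, Bwd w] @ q) Y \<Longrightarrow>
    loc_eq C W X Y (p @ [Fwd w, Bwd w] @ q) (p @ q)"
| bwd_fwd: "is_path C W X (p @ [Bwd w, Fwd w] @ q) Y \<Longrightarrow>
    loc_eq C W X Y (p @ [Bwd w, Fwd w] @ q) (p @ q)"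

type_synonym ('o, 'm) larrow = "'o \<times> 'o \<times> 'm step list set"

definition loc_class ::
  "('o, 'm, 'c) cat_scheme \<Rightarrow> 'm set \<Rightarrow> 'o \<Rightarrow> 'o \<Rightarrow> 'm step list \<Rightarrow> ('o, 'm) larrow" where
  "loc_class C W X Y p = (X, Y, {q. loc_eq C W X Y p q})"

definition localization ::
  "('o, 'm, 'c) cat_scheme \<Rightarrow> 'm set \<Rightarrow> ('o, ('o, 'm) larrow) cat" where
  "localization C W =
     \<lparr>obj = obj C,
      arr = {loc_class C W X Y p | X Y p. X \<in> obj C \<and> Y \<in> obj C \<and> is_path C W X p Y},
      Dom = (\<lambda>(X, Y, a). X),
      Cod = (\<lambda>(X, Y, a). Y),
      ident = (\<lambda>X. loc_class C W X X []),
      comp = (\<lambda>(Y', Z, b) (X, Y, a).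
        (X, Z, \<Union>p\<in>a. \<Union>q\<in>b. snd (snd (loc_class C W X Z (p @ q)))))\<rparr>"

definition loc_functor :: "('o, 'm, 'c) cat_scheme \<Rightarrow> 'm set \<Rightarrow> 'm \<Rightarrow> ('o, 'm) larrow" where
  "loc_functor C W f = loc_class C W (Dom C f) (Cod C f) [Fwd f]"

definition roof :: "('o, 'm, 'c) cat_scheme \<Rightarrow> 'm set \<Rightarrow> 'm \<Rightarrow> 'm \<Rightarrow> ('o, 'm) larrow" where
  "roof C W s g = loc_class C W (Cod C s) (Cod C g) [Bwd s, Fwd g]"

section \<open>The derived category and Ext\<close>

type_synonym ('o, 'm) darrow = "(('o, 'm) complex, ('o, 'm) harrow) larrow"

definition derived_category ::
  "('o, 'm, 'c) precat_scheme \<Rightarrow> (('o, 'm) complex, ('o, 'm) darrow) cat" where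
  "derived_category A = localization (homotopy_category A) (quasi_isos A)"

text \<open>
  The additive structure of the derived category is the one for which the localization functor is
  additive, so the zero of a Hom group is the image of the zero chain map.
\<close>

definition derived_zero ::
  "('o, 'm, 'c) precat_scheme \<Rightarrow> ('o, 'm) complex \<Rightarrow> ('o, 'm) complex \<Rightarrow> ('o, 'm) darrow" where
  "derived_zero A X Y =
     loc_functor (homotopy_category A) (quasi_isos A)
       (hclass A X Y (\<lambda>n. hzero A (ob X n) (ob Y n)))"

definition stalk :: "('o, 'm, 'c) precat_scheme \<Rightarrow> 'o \<Rightarrow> ('o, 'm) complex" where
  "stalk A B =
     (let S = (\<lambda>n::int. if n = 0 then B else zero_ob A)
      in \<lparr>ob = S, diff = (\<lambda>n. hzero A (S n) (S (n + 1)))\<rparr>)"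

definition shift ::
  "('o, 'm, 'c) precat_scheme \<Rightarrow> int \<Rightarrow> ('o, 'm) complex \<Rightarrow> ('o, 'm) complex" where
  "shift A i X =
     \<lparr>ob = (\<lambda>n. ob X (n + i)),
      diff = (\<lambda>n. if even i then diff X (n + i)
                  else inv\<^bsub>hom_group A (ob X (n + i)) (ob X (n + i + 1))\<^esub> diff X (n + i))\<rparr>"

definition Ext :: "('o, 'm, 'c) precat_scheme \<Rightarrow> nat \<Rightarrow> 'o \<Rightarrow> 'o \<Rightarrow> ('o, 'm) darrow set" where
  "Ext A i C B = Hom (derived_category A) (stalk A C) (shift A (int i) (stalk A B))"

definition Ext_zero :: "('o, 'm, 'c) precat_scheme \<Rightarrow> nat \<Rightarrow> 'o \<Rightarrow> 'o \<Rightarrow> ('o, 'm) darrow" where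
  "Ext_zero A i C B = derived_zero A (stalk A C) (shift A (int i) (stalk A B))"

section \<open>The class of an exact sequence\<close>

text \<open>
  The complex \<open>B \<rightarrow> E\<^sub>i \<rightarrow> \<dots> \<rightarrow> E\<^sub>1\<close> with \<open>B\<close> in degree \<open>-i\<close> and \<open>E\<^sub>1\<close> in degree \<open>0\<close>; its object in
  degree \<open>-k\<close> is the source of \<open>e k\<close>.
\<close>

definition yoneda_complex ::
  "('o, 'm, 'c) precat_scheme \<Rightarrow> nat \<Rightarrow> (nat \<Rightarrow> 'm) \<Rightarrow> ('o, 'm) complex" where
  "yoneda_complex A i e =
     (let S = (\<lambda>n::int. if - int i \<le> n \<and> n \<le> 0 then Dom A (e (nat (- n))) else zero_ob A)
      in \<lparr>ob = S,
          diff = (\<lambda>n. if - int i \<le> n \<and> n < 0 then e (nat (- n)) else hzero A (S n) (S (n + 1)))\<rparr>)"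

definition yoneda_s ::
  "('o, 'm, 'c) precat_scheme \<Rightarrow> nat \<Rightarrow> (nat \<Rightarrow> 'm) \<Rightarrow> int \<Rightarrow> 'm" where
  "yoneda_s A i e n =
     (if n = 0 then e 0
      else hzero A (ob (yoneda_complex A i e) n) (ob (stalk A (Cod A (e 0))) n))"

definition yoneda_g ::
  "('o, 'm, 'c) precat_scheme \<Rightarrow> nat \<Rightarrow> (nat \<Rightarrow> 'm) \<Rightarrow> int \<Rightarrow> 'm" where
  "yoneda_g A i e n =
     (if n = - int i then ident A (Dom A (e i))
      else hzero A (ob (yoneda_complex A i e) n)
             (ob (shift A (int i) (stalk A (Dom A (e i)))) n))"

definition yoneda_class ::
  "('o, 'm, 'c) precat_scheme \<Rightarrow> nat \<Rightarrow> (nat \<Rightarrow> 'm) \<Rightarrow> ('o, 'm) darrow" where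
  "yoneda_class A i e =
     (let L = yoneda_complex A i e
      in roof (homotopy_category A) (quasi_isos A)
           (hclass A L (stalk A (Cod A (e 0))) (yoneda_s A i e))
           (hclass A L (shift A (int i) (stalk A (Dom A (e i)))) (yoneda_g A i e)))"

section \<open>Consistency of the constructions\<close>

context category
begin

lemma is_path_obj: "is_path C W X p Y \<Longrightarrow> X \<in> obj C \<and> Y \<in> obj C"
proof (induction p arbitrary: X)
  case (Cons a p)
  then show ?case using Dom_obj Cod_obj by (cases a) auto
qed auto

lemma is_path_append:
  "is_path C W X (p @ q) Y \<longleftrightarrow> (\<exists>Z. is_path C W X p Z \<and> is_path C W Z q Y)"
proof (induction p arbitrary: X)
  case Nil
  then show ?case using is_path_obj by fastforce
next
  case (Cons a p)
  then show ?case by (cases a) auto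
qed

lemma loc_eq_path: "loc_eq C W X Y p q \<Longrightarrow> is_path C W X p Y \<and> is_path C W X q Y"
proof (induction rule: loc_eq.induct)
  case (ident Z p q)
  then show ?case using ident_Hom[of Z] by (auto simp: is_path_append Hom_def)
next
  case (comp p f g q)
  then show ?case using comp_Hom by (fastforce simp: is_path_append Hom_def)
qed (auto simp: is_path_append)

lemma loc_eq_append_right:
  "loc_eq C W X Y p p' \<Longrightarrow> is_path C W Y q Z \<Longrightarrow> loc_eq C W X Z (p @ q) (p' @ q)"
proof (induction rule: loc_eq.induct)
  case (refl p)
  then show ?case by (intro loc_eq.refl) (auto simp: is_path_append)
next
  case (sym p q)
  then show ?case by (blast intro: loc_eq.sym)
next
  case (trans p q r)
  then show ?case by (blast intro: loc_eq.trans)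
next
  case (ident Z' p r)
  then have "is_path C W X (p @ [Fwd (ident C Z')] @ (r @ q)) Z"
    by (auto simp: is_path_append)
  then show ?case using loc_eq.ident[OF ident(1)] by fastforce
next
  case (comp p f g r)
  then have "is_path C W X (p @ [Fwd f, Fwd g] @ (r @ q)) Z" by (auto simp: is_path_append)
  from loc_eq.comp[OF this] show ?case by simp
next
  case (fwd_bwd p w r)
  then have "is_path C W X (p @ [Fwd w, Bwd w] @ (r @ q)) Z" by (auto simp: is_path_append)
  from loc_eq.fwd_bwd[OF this] show ?case by simp
next
  case (bwd_fwd p w r)
  then have "is_path C W X (p @ [Bwd w, Fwd w] @ (r @ q)) Z" by (auto simp: is_path_append)
  from loc_eq.bwd_fwd[OF this] show ?case by simp
qed

lemma loc_eq_append_left: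
  "loc_eq C W Y Z p p' \<Longrightarrow> is_path C W X q Y \<Longrightarrow> loc_eq C W X Z (q @ p) (q @ p')"
proof (induction rule: loc_eq.induct)
  case (refl p)
  then show ?case by (intro loc_eq.refl) (auto simp: is_path_append)
next
  case (sym p q)
  then show ?case by (blast intro: loc_eq.sym)
next
  case (trans p q r)
  then show ?case by (blast intro: loc_eq.trans)
next
  case (ident Z' p r)
  then have "is_path C W X ((q @ p) @ [Fwd (ident C Z')] @ r) Z"
    by (auto simp: is_path_append)
  from loc_eq.ident[OF ident(1) this] show ?case by simp
next
  case (comp p f g r)
  then have "is_path C W X ((q @ p) @ [Fwd f, Fwd g] @ r) Z" by (auto simp: is_path_append)
  from loc_eq.comp[OF this] show ?case by simp
next
  case (fwd_bwd p w r)
  then have "is_path C W X ((q @ p) @ [Fwd w, Bwd w] @ r) Z" by (auto simp: is_path_append)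
  from loc_eq.fwd_bwd[OF this] show ?case by simp
next
  case (bwd_fwd p w r)
  then have "is_path C W X ((q @ p) @ [Bwd w, Fwd w] @ r) Z" by (auto simp: is_path_append)
  from loc_eq.bwd_fwd[OF this] show ?case by simp
qed

lemma loc_class_eq_iff:
  "is_path C W X p Y \<Longrightarrow> loc_class C W X Y p = loc_class C W X Y q \<longleftrightarrow> loc_eq C W X Y p q"
  unfolding loc_class_def by (auto intro: loc_eq.intros dest: loc_eq.sym loc_eq.trans)

lemma loc_class_Hom:
  "is_path C W X p Y \<Longrightarrow> loc_class C W X Y p \<in> Hom (localization C W) X Y"
  using is_path_obj by (fastforce simp: Hom_def localization_def loc_class_def)

lemma localization_Hom_cases:
  assumes "a \<in> Hom (localization C W) X Y"
  obtains p where "is_path C W X p Y" "a = loc_class C W X Y p"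
  using assms by (auto simp: Hom_def localization_def loc_class_def)

lemma loc_class_comp:
  assumes p: "is_path C W X p Y" and q: "is_path C W Y q Z"
  shows "loc_class C W Y Z q \<cdot>\<^bsub>localization C W\<^esub> loc_class C W X Y p =
    loc_class C W X Z (p @ q)"
proof -
  have *: "loc_eq C W X Z (p @ q) (p' @ q')"
    if "loc_eq C W X Y p p'" "loc_eq C W Y Z q q'" for p' q'
    using loc_eq_append_right[OF that(1) q] loc_eq_append_left[OF that(2)]
      loc_eq_path[OF that(1)] by (blast intro: loc_eq.trans)
  have eq: "{r. loc_eq C W X Z (p' @ q') r} = {r. loc_eq C W X Z (p @ q) r}"
    if "p' \<in> {r. loc_eq C W X Y p r}" "q' \<in> {r. loc_eq C W Y Z q r}" for p' q'
  proof -
    have "loc_eq C W X Z (p @ q) (p' @ q')" using * that by simp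
    then have "loc_class C W X Z (p @ q) = loc_class C W X Z (p' @ q')"
      using loc_class_eq_iff loc_eq_path by blast
    then show ?thesis by (simp add: loc_class_def)
  qed
  have ne: "p \<in> {r. loc_eq C W X Y p r}" "q \<in> {r. loc_eq C W Y Z q r}"
    using p q by (auto intro: loc_eq.refl)
  have "(\<Union>p'\<in>{r. loc_eq C W X Y p r}. \<Union>q'\<in>{r. loc_eq C W Y Z q r}.
      {r. loc_eq C W X Z (p' @ q') r}) = {r. loc_eq C W X Z (p @ q) r}" (is "?U = ?R")
  proof (intro equalityI subsetI)
    fix r assume "r \<in> ?U"
    then obtain p' q' where "p' \<in> {r. loc_eq C W X Y p r}" "q' \<in> {r. loc_eq C W Y Z q r}"
      "r \<in> {r. loc_eq C W X Z (p' @ q') r}" by (elim UN_E)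
    then show "r \<in> ?R" using eq by metis
  next
    fix r assume "r \<in> ?R"
    then show "r \<in> ?U" using ne by (intro UN_I)
  qed
  then show ?thesis by (simp add: localization_def loc_class_def)
qed

theorem category_localization: "category (localization C W)"
proof
  fix f g h X Y Z V
  let ?L = "localization C W"
  show "Dom ?L f \<in> obj ?L" "Cod ?L f \<in> obj ?L" if "f \<in> arr ?L"
    using that by (auto simp: localization_def loc_class_def)
  show id: "ident ?L X \<in> Hom ?L X X" if "X \<in> obj ?L" for X
    using loc_class_Hom[of W X "[]" X] that by (simp add: localization_def)
  show "g \<cdot>\<^bsub>?L\<^esub> f \<in> Hom ?L X Z" if fg: "f \<in> Hom ?L X Y" "g \<in> Hom ?L Y Z"
  proof -
    obtain p where p: "is_path C W X p Y" "f = loc_class C W X Y p"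
      using fg(1) by (rule localization_Hom_cases)
    obtain q where q: "is_path C W Y q Z" "g = loc_class C W Y Z q"
      using fg(2) by (rule localization_Hom_cases)
    show ?thesis
      unfolding p(2) q(2) loc_class_comp[OF p(1) q(1)]
      using p(1) q(1) by (intro loc_class_Hom) (auto simp: is_path_append)
  qed
  have idd: "ident ?L X = loc_class C W X X []" for X by (simp add: localization_def)
  show "f \<cdot>\<^bsub>?L\<^esub> ident ?L X = f" "ident ?L Y \<cdot>\<^bsub>?L\<^esub> f = f" if f: "f \<in> Hom ?L X Y"
  proof -
    obtain p where p: "is_path C W X p Y" "f = loc_class C W X Y p"
      using f by (rule localization_Hom_cases)
    have "is_path C W X [] X" "is_path C W Y [] Y" using is_path_obj[OF p(1)] by simp_all
    then show "f \<cdot>\<^bsub>?L\<^esub> ident ?L X = f" "ident ?L Y \<cdot>\<^bsub>?L\<^esub> f = f"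
      unfolding p(2) idd using loc_class_comp p(1) by fastforce+
  qed
  show "(h \<cdot>\<^bsub>?L\<^esub> g) \<cdot>\<^bsub>?L\<^esub> f = h \<cdot>\<^bsub>?L\<^esub> (g \<cdot>\<^bsub>?L\<^esub> f)"
    if fgh: "f \<in> Hom ?L X Y" "g \<in> Hom ?L Y Z" "h \<in> Hom ?L Z V"
  proof -
    obtain p where p: "is_path C W X p Y" "f = loc_class C W X Y p"
      using fgh(1) by (rule localization_Hom_cases)
    obtain q where q: "is_path C W Y q Z" "g = loc_class C W Y Z q"
      using fgh(2) by (rule localization_Hom_cases)
    obtain r where r: "is_path C W Z r V" "h = loc_class C W Z V r"
      using fgh(3) by (rule localization_Hom_cases)
    have "is_path C W X (p @ q) Z" "is_path C W Y (q @ r) V"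
      using p q r by (auto simp: is_path_append)
    then show ?thesis
      unfolding p(2) q(2) r(2) using loc_class_comp p(1) q(1) r(1) by (metis append_assoc)
  qed
qed

lemma loc_functor_ident: "X \<in> obj C \<Longrightarrow> loc_functor C W (ident C X) = ident (localization C W) X"
  using ident_Hom[of X] loc_eq.ident[of X C W X "[]" "[]" X]
  by (auto simp: loc_functor_def localization_def Hom_def loc_class_eq_iff)

lemma loc_functor_comp:
  assumes "f \<in> Hom C X Y" "g \<in> Hom C Y Z"
  shows "loc_functor C W (g \<cdot> f) = loc_functor C W g \<cdot>\<^bsub>localization C W\<^esub> loc_functor C W f"
proof -
  have p: "is_path C W X [Fwd f, Fwd g] Z"
    using assms Cod_obj by (auto simp: Hom_def)
  have "loc_eq C W X Z [Fwd f, Fwd g] [Fwd (g \<cdot> f)]"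
    using loc_eq.comp[of C W X "[]" f g "[]" Z] p by auto
  then show ?thesis using assms comp_Hom[OF assms] p Cod_obj
    by (auto simp: loc_functor_def Hom_def loc_class_comp loc_class_eq_iff[symmetric])
qed

lemma loc_functor_inverse:
  assumes "w \<in> W" "w \<in> Hom C X Y"
  shows "loc_class C W Y X [Bwd w] \<cdot>\<^bsub>localization C W\<^esub> loc_functor C W w = ident (localization C W) X"
    and "loc_functor C W w \<cdot>\<^bsub>localization C W\<^esub> loc_class C W Y X [Bwd w] = ident (localization C W) Y"
proof -
  have p: "is_path C W X [Fwd w, Bwd w] X" "is_path C W Y [Bwd w, Fwd w] Y"
    using assms Cod_obj Dom_obj by (auto simp: Hom_def)
  have "loc_eq C W X X [Fwd w, Bwd w] []" "loc_eq C W Y Y [Bwd w, Fwd w] []"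
    using loc_eq.fwd_bwd[of C W X "[]" w "[]" X] loc_eq.bwd_fwd[of C W Y "[]" w "[]" Y] p by auto
  then have "loc_class C W X X [Fwd w, Bwd w] = loc_class C W X X []"
    "loc_class C W Y Y [Bwd w, Fwd w] = loc_class C W Y Y []"
    using p by (simp_all only: loc_class_eq_iff)
  moreover have "is_path C W X [Fwd w] Y" "is_path C W Y [Bwd w] X"
    using assms Cod_obj Dom_obj by (auto simp: Hom_def)
  ultimately show "loc_class C W Y X [Bwd w] \<cdot>\<^bsub>localization C W\<^esub> loc_functor C W w = ident (localization C W) X"
    "loc_functor C W w \<cdot>\<^bsub>localization C W\<^esub> loc_class C W Y X [Bwd w] = ident (localization C W) Y"
    using assms(2) by (auto simp: loc_functor_def Hom_def loc_class_comp) (auto simp: localization_def)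
qed

lemma roof_eq:
  assumes "s \<in> W" "s \<in> Hom C L X" "g \<in> Hom C L Y"
  shows "roof C W s g = loc_functor C W g \<cdot>\<^bsub>localization C W\<^esub> loc_class C W X L [Bwd s]"
proof -
  have "is_path C W X [Bwd s] L" "is_path C W L [Fwd g] Y"
    using assms Cod_obj Dom_obj by (auto simp: Hom_def)
  then show ?thesis using assms(2,3) by (auto simp: roof_def loc_functor_def Hom_def loc_class_comp)
qed

lemma loc_eq_zero:
  assumes z: "\<And>X Y. X \<in> obj C \<Longrightarrow> Y \<in> obj C \<Longrightarrow> z X Y \<in> Hom C X Y"
    and zr: "\<And>f X Y Z. f \<in> Hom C X Y \<Longrightarrow> Z \<in> obj C \<Longrightarrow> f \<cdot> z Z X = z Z Y"
    and zl: "\<And>f X Y Z. f \<in> Hom C X Y \<Longrightarrow> Z \<in> obj C \<Longrightarrow> z Y Z \<cdot> f = z X Z"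
    and Z: "Z \<in> obj C"
  shows "is_path C W X p Y \<Longrightarrow> loc_eq C W Z Y (Fwd (z Z X) # p) [Fwd (z Z Y)]"
    and "is_path C W X p Y \<Longrightarrow> loc_eq C W X Z (p @ [Fwd (z Y Z)]) [Fwd (z X Z)]"
proof -
  have zs: "z X Y \<in> arr C" "Dom C (z X Y) = X" "Cod C (z X Y) = Y" if "X \<in> obj C" "Y \<in> obj C" for X Y
    using z[OF that] by (auto simp: Hom_def)
  show "is_path C W X p Y \<Longrightarrow> loc_eq C W Z Y (Fwd (z Z X) # p) [Fwd (z Z Y)]"
  proof (induction p arbitrary: X)
    case Nil
    then show ?case using zs[OF Z] by (auto intro: loc_eq.refl)
  next
    case (Cons a p)
    show ?case
    proof (cases a)
      case (Fwd f)
      with Cons.prems have f: "f \<in> Hom C X (Cod C f)" "X \<in> obj C" "Cod C f \<in> obj C"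
        and p: "is_path C W (Cod C f) p Y"
        using is_path_obj[of W "Cod C f" p Y] Dom_obj[of f] by (auto simp: Hom_def)
      have "is_path C W Z ([] @ [Fwd (z Z X), Fwd f] @ p) Y"
        using Cons.prems Fwd zs[OF Z f(2)] by simp
      from loc_eq.comp[OF this] have "loc_eq C W Z Y (Fwd (z Z X) # a # p) (Fwd (z Z (Cod C f)) # p)"
        using zr[OF f(1) Z] Fwd by simp
      then show ?thesis using Cons.IH[OF p] by (rule loc_eq.trans)
    next
      case (Bwd w)
      with Cons.prems have w: "w \<in> Hom C (Dom C w) X" "X \<in> obj C" "Dom C w \<in> obj C"
        and p: "is_path C W (Dom C w) p Y"
        using is_path_obj[of W "Dom C w" p Y] Cod_obj[of w] by (auto simp: Hom_def)
      have path: "is_path C W Z ([] @ [Fwd (z Z (Dom C w)), Fwd w] @ Bwd w # p) Y"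
        "is_path C W Z ([Fwd (z Z (Dom C w))] @ [Fwd w, Bwd w] @ p) Y"
        using Cons.prems Bwd zs[OF Z w(3)] by simp_all
      have "loc_eq C W Z Y (Fwd (z Z X) # a # p) (Fwd (z Z (Dom C w)) # Fwd w # Bwd w # p)"
        using loc_eq.comp[OF path(1), THEN loc_eq.sym] zr[OF w(1) Z] Bwd by simp
      moreover have "loc_eq C W Z Y (Fwd (z Z (Dom C w)) # Fwd w # Bwd w # p) (Fwd (z Z (Dom C w)) # p)"
        using loc_eq.fwd_bwd[OF path(2)] by simp
      ultimately show ?thesis using Cons.IH[OF p] by (blast intro: loc_eq.trans)
    qed
  qed
  show "is_path C W X p Y \<Longrightarrow> loc_eq C W X Z (p @ [Fwd (z Y Z)]) [Fwd (z X Z)]"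
  proof (induction p arbitrary: X)
    case Nil
    then show ?case using zs[OF _ Z] Z by (auto intro: loc_eq.refl)
  next
    case (Cons a p)
    show ?case
    proof (cases a)
      case (Fwd f)
      with Cons.prems have f: "f \<in> Hom C X (Cod C f)" "X \<in> obj C" "Cod C f \<in> obj C" "f \<in> arr C"
        and p: "is_path C W (Cod C f) p Y"
        using is_path_obj[of W "Cod C f" p Y] Dom_obj[of f] by (auto simp: Hom_def)
      have a: "is_path C W X [a] (Cod C f)" using Fwd f by (auto simp: Hom_def)
      have path: "is_path C W X ([] @ [Fwd f, Fwd (z (Cod C f) Z)] @ []) Z"
        using f zs[OF f(3) Z] Z by (auto simp: Hom_def)
      have "loc_eq C W X Z (a # p @ [Fwd (z Y Z)]) [Fwd f, Fwd (z (Cod C f) Z)]"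
        using loc_eq_append_left[OF Cons.IH[OF p] a] Fwd by simp
      then show ?thesis using loc_eq.comp[OF path] zl[OF f(1) Z] by (auto intro: loc_eq.trans)
    next
      case (Bwd w)
      with Cons.prems have w: "w \<in> Hom C (Dom C w) X" "X \<in> obj C" "Dom C w \<in> obj C" "w \<in> arr C" "w \<in> W"
        and p: "is_path C W (Dom C w) p Y"
        using is_path_obj[of W "Dom C w" p Y] Cod_obj[of w] by (auto simp: Hom_def)
      have a: "is_path C W X [a] (Dom C w)" using Bwd w by (auto simp: Hom_def)
      have path: "is_path C W X ([Bwd w] @ [Fwd w, Fwd (z X Z)] @ []) Z"
        "is_path C W X ([] @ [Bwd w, Fwd w] @ [Fwd (z X Z)]) Z"
        using w zs[OF w(2) Z] Z by (auto simp: Hom_def)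
      have "loc_eq C W X Z (a # p @ [Fwd (z Y Z)]) [Bwd w, Fwd (z (Dom C w) Z)]"
        using loc_eq_append_left[OF Cons.IH[OF p] a] Bwd by simp
      moreover have "loc_eq C W X Z [Bwd w, Fwd (z (Dom C w) Z)] [Bwd w, Fwd w, Fwd (z X Z)]"
        using loc_eq.comp[OF path(1), THEN loc_eq.sym] zl[OF w(1) Z] by simp
      moreover have "loc_eq C W X Z [Bwd w, Fwd w, Fwd (z X Z)] [Fwd (z X Z)]"
        using loc_eq.bwd_fwd[OF path(2)] by simp
      ultimately show ?thesis by (auto intro: loc_eq.trans)
    qed
  qed
qed

end

context preadditive_category
begin

lemma Hom_obj: "f \<in> Hom A X Y \<Longrightarrow> X \<in> obj A \<and> Y \<in> obj A"
  using Dom_obj Cod_obj by (auto simp: Hom_def)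

lemma hzero_Hom: "X \<in> obj A \<Longrightarrow> Y \<in> obj A \<Longrightarrow> hzero A X Y \<in> Hom A X Y"
proof -
  assume "X \<in> obj A" "Y \<in> obj A"
  then interpret comm_group "hom_group A X Y" by (rule hom_comm_group)
  show ?thesis using one_closed by (simp add: hom_group_def)
qed

lemma hplus_Hom:
  assumes "f \<in> Hom A X Y" "g \<in> Hom A X Y"
  shows "f \<oplus> g \<in> Hom A X Y"
proof -
  interpret comm_group "hom_group A X Y" using Hom_obj[OF assms(1)] hom_comm_group by blast
  show ?thesis using m_closed assms by (simp add: hom_group_def)
qed

lemma hplus_assoc:
  assumes "f \<in> Hom A X Y" "g \<in> Hom A X Y" "h \<in> Hom A X Y"
  shows "(f \<oplus> g) \<oplus> h = f \<oplus> (g \<oplus> h)"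
proof -
  interpret comm_group "hom_group A X Y" using Hom_obj[OF assms(1)] hom_comm_group by blast
  show ?thesis using m_assoc assms by (simp add: hom_group_def)
qed

lemma hplus_comm:
  assumes "f \<in> Hom A X Y" "g \<in> Hom A X Y"
  shows "f \<oplus> g = g \<oplus> f"
proof -
  interpret comm_group "hom_group A X Y" using Hom_obj[OF assms(1)] hom_comm_group by blast
  show ?thesis using m_comm assms by (simp add: hom_group_def)
qed

lemma hplus_interchange:
  assumes "k \<in> Hom A X Y" "a \<in> Hom A X Y" "b \<in> Hom A X Y" "c \<in> Hom A X Y" "d \<in> Hom A X Y"
  shows "(k \<oplus> (a \<oplus> b)) \<oplus> (c \<oplus> d) = k \<oplus> ((c \<oplus> a) \<oplus> (d \<oplus> b))"
proof -
  interpret comm_group "hom_group A X Y" using Hom_obj[OF assms(1)] hom_comm_group by blast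
  have [simp]: "mult (hom_group A X Y) = (\<oplus>)" "carrier (hom_group A X Y) = Hom A X Y"
    by (simp_all add: hom_group_def)
  show ?thesis using m_ac m_closed assms by simp
qed

lemma hplus_hzero:
  assumes "f \<in> Hom A X Y"
  shows "f \<oplus> hzero A X Y = f" "hzero A X Y \<oplus> f = f"
proof -
  interpret comm_group "hom_group A X Y" using Hom_obj[OF assms(1)] hom_comm_group by blast
  show "f \<oplus> hzero A X Y = f" "hzero A X Y \<oplus> f = f"
    using r_one l_one assms by (simp_all add: hom_group_def)
qed

definition  hneg :: "'m \<Rightarrow> 'm" where "hneg f = inv\<^bsub>hom_group A (Dom A f) (Cod A f)\<^esub> f"

lemma hneg:
  assumes "f \<in> Hom A X Y"
  shows "hneg f \<in> Hom A X Y" "f \<oplus> hneg f = hzero A X Y"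
proof -
  interpret comm_group "hom_group A X Y" using Hom_obj[OF assms(1)] hom_comm_group by blast
  have "hneg f = inv\<^bsub>hom_group A X Y\<^esub> f" using assms by (auto simp: hneg_def Hom_def)
  then show "hneg f \<in> Hom A X Y" "f \<oplus> hneg f = hzero A X Y"
    using inv_closed r_inv assms by (simp_all add: hom_group_def)
qed

lemma hplus_cancel:
  assumes "f \<in> Hom A X Y" "g \<in> Hom A X Y" "h \<in> Hom A X Y" "f \<oplus> g = f \<oplus> h"
  shows "g = h"
proof -
  interpret comm_group "hom_group A X Y" using Hom_obj[OF assms(1)] hom_comm_group by blast
  show ?thesis using Units_l_cancel[of f g h] assms by (simp add: hom_group_def Units_eq[unfolded hom_group_def])
qed

lemma hplus_hneg_cancel:
  assumes "k \<in> Hom A X Y" "a \<in> Hom A X Y" "b \<in> Hom A X Y"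
  shows "(k \<oplus> (a \<oplus> b)) \<oplus> (hneg a \<oplus> hneg b) = k"
proof -
  note n = hneg[OF assms(2)] hneg[OF assms(3)]
  have z: "hzero A X Y \<in> Hom A X Y" using assms(1) Hom_obj hzero_Hom by blast
  have "(k \<oplus> (a \<oplus> b)) \<oplus> (hneg a \<oplus> hneg b) = k \<oplus> ((hneg a \<oplus> a) \<oplus> (hneg b \<oplus> b))"
    using hplus_interchange assms n by blast
  also have "\<dots> = k \<oplus> ((a \<oplus> hneg a) \<oplus> (b \<oplus> hneg b))"
    using hplus_comm assms n by metis
  also have "\<dots> = k" using n hplus_hzero[OF z] hplus_hzero[OF assms(1)] by simp
  finally show ?thesis .
qed

lemma comp_hzero_right:
  assumes "g \<in> Hom A Y Z" "X \<in> obj A"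
  shows "g \<cdot> hzero A X Y = hzero A X Z"
proof -
  have z: "hzero A X Y \<in> Hom A X Y" "hzero A X Z \<in> Hom A X Z"
    using assms Hom_obj hzero_Hom by blast+
  have gz: "g \<cdot> hzero A X Y \<in> Hom A X Z" using comp_Hom[OF z(1) assms(1)] .
  have "g \<cdot> hzero A X Y = g \<cdot> (hzero A X Y \<oplus> hzero A X Y)" using z hplus_hzero by simp
  also have "\<dots> = (g \<cdot> hzero A X Y) \<oplus> (g \<cdot> hzero A X Y)" using z assms comp_hplus_right by blast
  finally show ?thesis using hplus_cancel[OF gz gz z(2)] hplus_hzero[OF gz] by simp
qed

lemma comp_hzero_left:
  assumes "g \<in> Hom A X Y" "Z \<in> obj A"
  shows "hzero A Y Z \<cdot> g = hzero A X Z"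
proof -
  have z: "hzero A Y Z \<in> Hom A Y Z" "hzero A X Z \<in> Hom A X Z"
    using assms Hom_obj hzero_Hom by blast+
  have gz: "hzero A Y Z \<cdot> g \<in> Hom A X Z" using comp_Hom[OF assms(1) z(1)] .
  have "hzero A Y Z \<cdot> g = (hzero A Y Z \<oplus> hzero A Y Z) \<cdot> g" using z hplus_hzero by simp
  also have "\<dots> = (hzero A Y Z \<cdot> g) \<oplus> (hzero A Y Z \<cdot> g)" using z assms comp_hplus_left by blast
  finally show ?thesis using hplus_cancel[OF gz gz z(2)] hplus_hzero[OF gz] by simp
qed

lemma hneg_comp:
  assumes "f \<in> Hom A X Y" "g \<in> Hom A Y Z"
  shows "hneg g \<cdot> f = hneg (g \<cdot> f)" "g \<cdot> hneg f = hneg (g \<cdot> f)"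
proof -
  have gf: "g \<cdot> f \<in> Hom A X Z" using comp_Hom assms by blast
  note n = hneg[OF assms(1)] hneg[OF assms(2)] hneg[OF gf]
  have m: "hneg g \<cdot> f \<in> Hom A X Z" "g \<cdot> hneg f \<in> Hom A X Z" using n comp_Hom assms by blast+
  have "(g \<cdot> f) \<oplus> (hneg g \<cdot> f) = hzero A X Z"
    using comp_hplus_left[OF assms n(3)] n comp_hzero_left assms Hom_obj by metis
  then show "hneg g \<cdot> f = hneg (g \<cdot> f)" using hplus_cancel[OF gf m(1) n(5)] n by simp
  have "(g \<cdot> f) \<oplus> (g \<cdot> hneg f) = hzero A X Z"
    using comp_hplus_right[OF assms(1) n(1) assms(2)] n comp_hzero_right assms Hom_obj by metis
  then show "g \<cdot> hneg f = hneg (g \<cdot> f)" using hplus_cancel[OF gf m(2) n(5)] n by simp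
qed

lemma complexD:
  assumes "is_complex A X"
  shows "ob X n \<in> obj A" "diff X n \<in> Hom A (ob X n) (ob X (n + 1))"
    "diff X (n - 1) \<in> Hom A (ob X (n - 1)) (ob X n)"
proof -
  show "ob X n \<in> obj A" "diff X n \<in> Hom A (ob X n) (ob X (n + 1))" for n
    using assms unfolding is_complex_def by auto
  from this(2)[of "n - 1"] show "diff X (n - 1) \<in> Hom A (ob X (n - 1)) (ob X n)" by simp
qed

lemma chain_mapD:
  assumes "chain_map A X Y f"
  shows "f n \<in> Hom A (ob X n) (ob Y n)" "f (n + 1) \<cdot> diff X n = diff Y n \<cdot> f n"
  using assms unfolding chain_map_def by auto

lemma homotopic_refl:
  assumes "is_complex A X" "is_complex A Y" "chain_map A X Y f"
  shows "homotopic A X Y f f"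
  unfolding homotopic_def
proof (intro exI conjI allI)
  fix n
  let ?h = "\<lambda>n. hzero A (ob X n) (ob Y (n - 1))"
  show "?h n \<in> Hom A (ob X n) (ob Y (n - 1))" using hzero_Hom complexD assms by blast
  show "f n = f n \<oplus> ((diff Y (n - 1) \<cdot> ?h n) \<oplus> (?h (n + 1) \<cdot> diff X n))"
    using comp_hzero_right[OF complexD(3)[OF assms(2)] complexD(1)[OF assms(1), of n], of n]
      comp_hzero_left[OF complexD(2)[OF assms(1)] complexD(1)[OF assms(2)], of n n]
      hplus_hzero hzero_Hom complexD(1) assms chain_mapD(1)[OF assms(3), of n] by simp
qed

lemma homotopy_terms:
  assumes "is_complex A X" "is_complex A Y" "\<And>n. h n \<in> Hom A (ob X n) (ob Y (n - 1))"
  shows "diff Y (n - 1) \<cdot> h n \<in> Hom A (ob X n) (ob Y n)"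
    "h (n + 1) \<cdot> diff X n \<in> Hom A (ob X n) (ob Y n)"
    "h (n + 1) \<in> Hom A (ob X (n + 1)) (ob Y n)"
proof -
  show *: "h (n + 1) \<in> Hom A (ob X (n + 1)) (ob Y n)" using assms(3)[of "n + 1"] by simp
  show "diff Y (n - 1) \<cdot> h n \<in> Hom A (ob X n) (ob Y n)"
    "h (n + 1) \<cdot> diff X n \<in> Hom A (ob X n) (ob Y n)"
    by (rule comp_Hom[OF assms(3) complexD(3)[OF assms(2)]])
      (rule comp_Hom[OF complexD(2)[OF assms(1)] *])
qed

lemma homotopic_sym:
  assumes X: "is_complex A X" and Y: "is_complex A Y" and g: "chain_map A X Y g"
    and "homotopic A X Y f g"
  shows "homotopic A X Y g f"
proof -
  obtain h where h: "\<And>n. h n \<in> Hom A (ob X n) (ob Y (n - 1))"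
    and e: "\<And>n. f n = g n \<oplus> ((diff Y (n - 1) \<cdot> h n) \<oplus> (h (n + 1) \<cdot> diff X n))"
    using assms(4) unfolding homotopic_def by blast
  show ?thesis
    unfolding homotopic_def
  proof (intro exI conjI allI)
    fix n
    show "hneg (h n) \<in> Hom A (ob X n) (ob Y (n - 1))" using hneg h by blast
    note t = homotopy_terms[OF X Y, of h, OF h, of n]
    let ?a = "diff Y (n - 1) \<cdot> h n" and ?b = "h (n + 1) \<cdot> diff X n"
    have eq: "diff Y (n - 1) \<cdot> hneg (h n) = hneg ?a" "hneg (h (n + 1)) \<cdot> diff X n = hneg ?b"
      using hneg_comp(2)[OF h complexD(3)[OF Y]] hneg_comp(1)[OF complexD(2)[OF X] t(3)] by simp_all
    have "f n \<oplus> (hneg ?a \<oplus> hneg ?b) = g n"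
      unfolding e[of n] using hplus_hneg_cancel[OF chain_mapD(1)[OF g] t(1,2)] .
    then show "g n = f n \<oplus> ((diff Y (n - 1) \<cdot> hneg (h n)) \<oplus> (hneg (h (n + 1)) \<cdot> diff X n))"
      using eq by simp
  qed
qed

lemma homotopic_trans:
  assumes X: "is_complex A X" and Y: "is_complex A Y" and k: "chain_map A X Y k"
    and "homotopic A X Y f g" "homotopic A X Y g k"
  shows "homotopic A X Y f k"
proof -
  obtain h where h: "\<And>n. h n \<in> Hom A (ob X n) (ob Y (n - 1))"
    and e: "\<And>n. f n = g n \<oplus> ((diff Y (n - 1) \<cdot> h n) \<oplus> (h (n + 1) \<cdot> diff X n))"
    using assms(4) unfolding homotopic_def by blast
  obtain h' where h': "\<And>n. h' n \<in> Hom A (ob X n) (ob Y (n - 1))"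
    and e': "\<And>n. g n = k n \<oplus> ((diff Y (n - 1) \<cdot> h' n) \<oplus> (h' (n + 1) \<cdot> diff X n))"
    using assms(5) unfolding homotopic_def by blast
  show ?thesis
    unfolding homotopic_def
  proof (intro exI conjI allI)
    fix n
    show "h n \<oplus> h' n \<in> Hom A (ob X n) (ob Y (n - 1))" using hplus_Hom h h' by blast
    note t = homotopy_terms[OF X Y, of h, OF h, of n] and t' = homotopy_terms[OF X Y, of h', OF h', of n]
    show "f n = k n \<oplus> ((diff Y (n - 1) \<cdot> (h n \<oplus> h' n)) \<oplus> ((h (n + 1) \<oplus> h' (n + 1)) \<cdot> diff X n))"
      unfolding comp_hplus_right[OF h h' complexD(3)[OF Y]]
        comp_hplus_left[OF complexD(2)[OF X] t(3) t'(3)] e[of n] e'[of n]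
      using hplus_interchange[OF chain_mapD(1)[OF k, of n] t'(1,2) t(1,2)] .
  qed
qed

lemma chain_map_comp:
  assumes X: "is_complex A X" and Y: "is_complex A Y" and Z: "is_complex A Z"
    and f: "chain_map A X Y f" and g: "chain_map A Y Z g"
  shows "chain_map A X Z (\<lambda>n. g n \<cdot> f n)"
  unfolding chain_map_def
proof (intro conjI allI)
  fix n
  note fn = chain_mapD[OF f] and gn = chain_mapD[OF g]
  note d = complexD(2)[OF X, of n] complexD(2)[OF Y, of n] complexD(2)[OF Z, of n]
  show "g n \<cdot> f n \<in> Hom A (ob X n) (ob Z n)" using comp_Hom[OF fn(1) gn(1)] .
  have "(g (n + 1) \<cdot> f (n + 1)) \<cdot> diff X n = g (n + 1) \<cdot> (f (n + 1) \<cdot> diff X n)"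
    by (rule comp_assoc[OF d(1) fn(1) gn(1)])
  also have "\<dots> = g (n + 1) \<cdot> (diff Y n \<cdot> f n)" by (simp only: fn(2))
  also have "\<dots> = (g (n + 1) \<cdot> diff Y n) \<cdot> f n" by (rule comp_assoc[OF fn(1) d(2) gn(1), symmetric])
  also have "\<dots> = (diff Z n \<cdot> g n) \<cdot> f n" by (simp only: gn(2))
  also have "\<dots> = diff Z n \<cdot> (g n \<cdot> f n)" by (rule comp_assoc[OF fn(1) gn(1) d(3)])
  finally show "(g (n + 1) \<cdot> f (n + 1)) \<cdot> diff X n = diff Z n \<cdot> (g n \<cdot> f n)" .
qed

lemma chain_map_ident: "is_complex A X \<Longrightarrow> chain_map A X X (\<lambda>n. ident A (ob X n))"
  unfolding chain_map_def
  by (auto simp: ident_Hom complexD(1) comp_ident_left[OF complexD(2)] comp_ident_right[OF complexD(2)])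

lemma chain_map_hzero:
  "is_complex A X \<Longrightarrow> is_complex A Y \<Longrightarrow> chain_map A X Y (\<lambda>n. hzero A (ob X n) (ob Y n))"
  unfolding chain_map_def
  by (auto simp: hzero_Hom complexD(1) comp_hzero_left[OF complexD(2)] comp_hzero_right[OF complexD(2)])

lemma homotopic_comp_left:
  assumes X: "is_complex A X" and Y: "is_complex A Y" and Z: "is_complex A Z"
    and f: "chain_map A X Y f'" and g: "chain_map A Y Z g" and "homotopic A X Y f f'"
  shows "homotopic A X Z (\<lambda>n. g n \<cdot> f n) (\<lambda>n. g n \<cdot> f' n)"
proof -
  obtain h where h: "\<And>n. h n \<in> Hom A (ob X n) (ob Y (n - 1))"
    and e: "\<And>n. f n = f' n \<oplus> ((diff Y (n - 1) \<cdot> h n) \<oplus> (h (n + 1) \<cdot> diff X n))"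
    using assms(6) unfolding homotopic_def by blast
  show ?thesis
    unfolding homotopic_def
  proof (intro exI conjI allI)
    fix n
    note t = homotopy_terms[OF X Y, of h, OF h, of n] and fn = chain_mapD[OF f] and gn = chain_mapD[OF g]
    show "g (n - 1) \<cdot> h n \<in> Hom A (ob X n) (ob Z (n - 1))" using comp_Hom[OF h gn(1)] .
    have "diff Z (n - 1) \<cdot> (g (n - 1) \<cdot> h n) = (diff Z (n - 1) \<cdot> g (n - 1)) \<cdot> h n"
      by (rule comp_assoc[OF h gn(1) complexD(3)[OF Z], symmetric])
    also have "\<dots> = (g n \<cdot> diff Y (n - 1)) \<cdot> h n" using gn(2)[of "n - 1"] by simp
    also have "\<dots> = g n \<cdot> (diff Y (n - 1) \<cdot> h n)"
      by (rule comp_assoc[OF h complexD(3)[OF Y] gn(1)])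
    finally have "diff Z (n - 1) \<cdot> (g (n - 1) \<cdot> h n) = g n \<cdot> (diff Y (n - 1) \<cdot> h n)" .
    moreover have "(g (n + 1 - 1) \<cdot> h (n + 1)) \<cdot> diff X n = g n \<cdot> (h (n + 1) \<cdot> diff X n)"
      using comp_assoc[OF complexD(2)[OF X, of n] t(3) gn(1)[of n]] by simp
    ultimately show "g n \<cdot> f n = g n \<cdot> f' n \<oplus>
        ((diff Z (n - 1) \<cdot> (g (n - 1) \<cdot> h n)) \<oplus> ((g (n + 1 - 1) \<cdot> h (n + 1)) \<cdot> diff X n))"
      unfolding e[of n]
      by (simp add: comp_hplus_right[OF fn(1) hplus_Hom[OF t(1,2)] gn(1)]
          comp_hplus_right[OF t(1,2) gn(1)])
  qed
qed

lemma homotopic_comp_right: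
  assumes X: "is_complex A X" and Y: "is_complex A Y" and Z: "is_complex A Z"
    and f: "chain_map A X Y f" and g: "chain_map A Y Z g'" and "homotopic A Y Z g g'"
  shows "homotopic A X Z (\<lambda>n. g n \<cdot> f n) (\<lambda>n. g' n \<cdot> f n)"
proof -
  obtain h where h: "\<And>n. h n \<in> Hom A (ob Y n) (ob Z (n - 1))"
    and e: "\<And>n. g n = g' n \<oplus> ((diff Z (n - 1) \<cdot> h n) \<oplus> (h (n + 1) \<cdot> diff Y n))"
    using assms(6) unfolding homotopic_def by blast
  show ?thesis
    unfolding homotopic_def
  proof (intro exI conjI allI)
    fix n
    note t = homotopy_terms[OF Y Z, of h, OF h, of n] and fn = chain_mapD[OF f] and gn = chain_mapD[OF g]
    show "h n \<cdot> f n \<in> Hom A (ob X n) (ob Z (n - 1))" using comp_Hom[OF fn(1) h] .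
    have "diff Z (n - 1) \<cdot> (h n \<cdot> f n) = (diff Z (n - 1) \<cdot> h n) \<cdot> f n"
      by (rule comp_assoc[OF fn(1) h complexD(3)[OF Z], symmetric])
    moreover have "(h (n + 1) \<cdot> f (n + 1)) \<cdot> diff X n = (h (n + 1) \<cdot> diff Y n) \<cdot> f n"
      by (simp only: comp_assoc[OF complexD(2)[OF X, of n] fn(1)[of "n + 1"] t(3)]
          comp_assoc[OF fn(1)[of n] complexD(2)[OF Y, of n] t(3)] fn(2)[of n])
    ultimately show "g n \<cdot> f n = g' n \<cdot> f n \<oplus>
        ((diff Z (n - 1) \<cdot> (h n \<cdot> f n)) \<oplus> ((h (n + 1) \<cdot> f (n + 1)) \<cdot> diff X n))"
      unfolding e[of n]
      by (simp add: comp_hplus_left[OF fn(1) gn(1) hplus_Hom[OF t(1,2)]]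
          comp_hplus_left[OF fn(1) t(1,2)])
  qed
qed

lemma hclass_eq_iff:
  assumes "is_complex A X" "is_complex A Y" "chain_map A X Y f" "chain_map A X Y g"
  shows "hclass A X Y f = hclass A X Y g \<longleftrightarrow> homotopic A X Y f g"
  unfolding hclass_def using assms homotopic_refl homotopic_sym homotopic_trans by blast

lemma hclass_Hom:
  "is_complex A X \<Longrightarrow> is_complex A Y \<Longrightarrow> chain_map A X Y f \<Longrightarrow>
    hclass A X Y f \<in> Hom (homotopy_category A) X Y"
  by (fastforce simp: Hom_def homotopy_category_def hclass_def)

lemma homotopy_Hom_cases:
  assumes "a \<in> Hom (homotopy_category A) X Y"
  obtains f where "is_complex A X" "is_complex A Y" "chain_map A X Y f" "a = hclass A X Y f"
  using assms by (auto simp: Hom_def homotopy_category_def hclass_def)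

lemma hclass_comp:
  assumes X: "is_complex A X" and Y: "is_complex A Y" and Z: "is_complex A Z"
    and f: "chain_map A X Y f" and g: "chain_map A Y Z g"
  shows "hclass A Y Z g \<cdot>\<^bsub>homotopy_category A\<^esub> hclass A X Y f = hclass A X Z (\<lambda>n. g n \<cdot> f n)"
proof -
  have "hclass A X Z (\<lambda>n. g' n \<cdot> f' n) = hclass A X Z (\<lambda>n. g n \<cdot> f n)"
    if "chain_map A X Y f'" "homotopic A X Y f f'" "chain_map A Y Z g'" "homotopic A Y Z g g'" for f' g'
  proof -
    have "homotopic A X Z (\<lambda>n. g n \<cdot> f n) (\<lambda>n. g' n \<cdot> f' n)"
      using homotopic_comp_left[OF X Y Z that(1) g that(2)]
        homotopic_comp_right[OF X Y Z that(1,3,4)]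
        homotopic_trans[OF X Z chain_map_comp[OF X Y Z that(1,3)]] by blast
    then show ?thesis
      using hclass_eq_iff[OF X Z] chain_map_comp[OF X Y Z] f g that by metis
  qed
  then have *: "snd (snd (hclass A X Z (\<lambda>n. g' n \<cdot> f' n))) = snd (snd (hclass A X Z (\<lambda>n. g n \<cdot> f n)))"
    if "f' \<in> snd (snd (hclass A X Y f))" "g' \<in> snd (snd (hclass A Y Z g))" for f' g'
    using that by (simp add: hclass_def)
  have ne: "f \<in> snd (snd (hclass A X Y f))" "g \<in> snd (snd (hclass A Y Z g))"
    using f g homotopic_refl X Y Z by (auto simp: hclass_def)
  have "(\<Union>f'\<in>snd (snd (hclass A X Y f)). \<Union>g'\<in>snd (snd (hclass A Y Z g)).
      snd (snd (hclass A X Z (\<lambda>n. g' n \<cdot> f' n)))) = snd (snd (hclass A X Z (\<lambda>n. g n \<cdot> f n)))"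
    using * ne by blast
  then show ?thesis by (simp add: homotopy_category_def hclass_def)
qed

theorem category_homotopy_category: "category (homotopy_category A)"
proof
  fix f g h X Y Z V
  let ?K = "homotopy_category A"
  have idd: "ident ?K X = hclass A X X (\<lambda>n. ident A (ob X n))" for X
    by (simp add: homotopy_category_def)
  show "Dom ?K f \<in> obj ?K" "Cod ?K f \<in> obj ?K" if "f \<in> arr ?K"
    using that by (auto simp: homotopy_category_def hclass_def)
  show "ident ?K X \<in> Hom ?K X X" if "X \<in> obj ?K"
    unfolding idd using that chain_map_ident by (intro hclass_Hom) (auto simp: homotopy_category_def)
  show "g \<cdot>\<^bsub>?K\<^esub> f \<in> Hom ?K X Z" if "f \<in> Hom ?K X Y" "g \<in> Hom ?K Y Z"
    using that by (elim homotopy_Hom_cases) (auto simp: hclass_comp intro!: hclass_Hom intro: chain_map_comp[of X Y Z])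
  show "f \<cdot>\<^bsub>?K\<^esub> ident ?K X = f" if "f \<in> Hom ?K X Y"
    using that unfolding idd
    by (elim homotopy_Hom_cases)
      (simp add: hclass_comp chain_map_ident comp_ident_right[OF chain_mapD(1)])
  show "ident ?K Y \<cdot>\<^bsub>?K\<^esub> f = f" if "f \<in> Hom ?K X Y"
    using that unfolding idd
    by (elim homotopy_Hom_cases)
      (simp add: hclass_comp chain_map_ident comp_ident_left[OF chain_mapD(1)])
  show "(h \<cdot>\<^bsub>?K\<^esub> g) \<cdot>\<^bsub>?K\<^esub> f = h \<cdot>\<^bsub>?K\<^esub> (g \<cdot>\<^bsub>?K\<^esub> f)"
    if "f \<in> Hom ?K X Y" "g \<in> Hom ?K Y Z" "h \<in> Hom ?K Z V"
    using that
    by (elim homotopy_Hom_cases)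
      (simp add: hclass_comp chain_map_comp[of X Y Z] chain_map_comp[of Y Z V]
        comp_assoc[OF chain_mapD(1) chain_mapD(1) chain_mapD(1)])
qed

corollary category_derived_category: "category (derived_category A)"
  unfolding derived_category_def
  by (rule category.category_localization[OF category_homotopy_category])

lemma hclass_hzero_comp:
  assumes "a \<in> Hom (homotopy_category A) X Y" "is_complex A Z"
  shows "a \<cdot>\<^bsub>homotopy_category A\<^esub> hclass A Z X (\<lambda>n. hzero A (ob Z n) (ob X n)) =
      hclass A Z Y (\<lambda>n. hzero A (ob Z n) (ob Y n))"
    and "hclass A Y Z (\<lambda>n. hzero A (ob Y n) (ob Z n)) \<cdot>\<^bsub>homotopy_category A\<^esub> a =
      hclass A X Z (\<lambda>n. hzero A (ob X n) (ob Z n))"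
  using assms
  by (auto elim!: homotopy_Hom_cases simp: hclass_comp chain_map_hzero
      comp_hzero_right[OF chain_mapD(1) complexD(1)] comp_hzero_left[OF chain_mapD(1) complexD(1)])

text \<open>
  Composing with any arrow on either side sends \<open>derived_zero\<close> to \<open>derived_zero\<close>; only one family of
  arrows can do this, so these are the zeros of the Hom groups.
\<close>

lemma derived_zero_comp:
  assumes a: "a \<in> Hom (derived_category A) X Y" and Z: "is_complex A Z"
  shows "a \<cdot>\<^bsub>derived_category A\<^esub> derived_zero A Z X = derived_zero A Z Y"
    and "derived_zero A Y Z \<cdot>\<^bsub>derived_category A\<^esub> a = derived_zero A X Z"
proof -
  let ?K = "homotopy_category A" and ?W = "quasi_isos A"
  let ?z = "\<lambda>X Y. hclass A X Y (\<lambda>n. hzero A (ob X n) (ob Y n))"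
  interpret K: category ?K by (rule category_homotopy_category)
  have ob: "obj ?K = {X. is_complex A X}" by (simp add: homotopy_category_def)
  have z: "?z X Y \<in> Hom ?K X Y" if "X \<in> obj ?K" "Y \<in> obj ?K" for X Y
    using that by (auto simp: ob intro: hclass_Hom chain_map_hzero)
  have zs: "?z X Y \<in> arr ?K" "Dom ?K (?z X Y) = X" "Cod ?K (?z X Y) = Y"
    if "X \<in> obj ?K" "Y \<in> obj ?K" for X Y
    using z[OF that] by (auto simp: Hom_def)
  obtain p where p: "is_path ?K ?W X p Y" and ap: "a = loc_class ?K ?W X Y p"
    using a K.localization_Hom_cases unfolding derived_category_def by blast
  have o: "X \<in> obj ?K" "Y \<in> obj ?K" "Z \<in> obj ?K" using K.is_path_obj[OF p] Z ob by auto
  have eq: "loc_eq ?K ?W Z Y (Fwd (?z Z X) # p) [Fwd (?z Z Y)]"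
    "loc_eq ?K ?W X Z (p @ [Fwd (?z Y Z)]) [Fwd (?z X Z)]"
    using K.loc_eq_zero[of ?z Z, OF z _ _ o(3) p] hclass_hzero_comp ob by blast+
  have dz: "derived_zero A X Y = loc_class ?K ?W X Y [Fwd (?z X Y)]"
    if "X \<in> obj ?K" "Y \<in> obj ?K" for X Y
    unfolding derived_zero_def loc_functor_def using zs[OF that] by simp
  have path: "is_path ?K ?W Z [Fwd (?z Z X)] X" "is_path ?K ?W Y [Fwd (?z Y Z)] Z"
    using zs o by simp_all
  show "a \<cdot>\<^bsub>derived_category A\<^esub> derived_zero A Z X = derived_zero A Z Y"
    unfolding derived_category_def ap dz[OF o(3,1)] dz[OF o(3,2)] K.loc_class_comp[OF path(1) p]
    using eq(1) K.loc_eq_path[OF eq(1)] by (subst K.loc_class_eq_iff) auto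
  show "derived_zero A Y Z \<cdot>\<^bsub>derived_category A\<^esub> a = derived_zero A X Z"
    unfolding derived_category_def ap dz[OF o(2,3)] dz[OF o(1,3)] K.loc_class_comp[OF p path(2)]
    using eq(2) K.loc_eq_path[OF eq(2)] by (subst K.loc_class_eq_iff) auto
qed

end

end

theory Submission
  imports Defs
begin

text \<open>
  Let \<open>(s, g)\<close> be the roof defining \<open>\<alpha>\<close>, with apex \<open>L = (F\<^sub>1 \<rightarrow> F\<^sub>2 \<rightarrow> G/F\<^sub>1)\<close>. The complex
  \<open>M = (F\<^sub>2 \<rightarrow> G)\<close> in degrees \<open>-1\<close> and \<open>0\<close> also resolves \<open>G/F\<^sub>2\<close>, and the identity of \<open>F\<^sub>2\<close> together with
  the projection \<open>G \<rightarrow> G/F\<^sub>1\<close> is a chain map \<open>t : M \<rightarrow> L\<close> for which \<open>s t\<close> is the augmentation of \<open>M\<close>,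
  again a quasi-isomorphism. Hence \<open>\<alpha>\<close> is represented by the roof \<open>(s t, g t)\<close> as well, and \<open>g t = 0\<close>
  because \<open>M\<close> vanishes in degree \<open>-2\<close>.
\<close>

section \<open>Refining a roof\<close>

context category
begin

section \<open>Roofs as arrows of the localization\<close>

lemma roof_Hom:
  assumes "s \<in> W" "s \<in> Hom C L X" "g \<in> Hom C L Y"
  shows "roof C W s g \<in> Hom (localization C W) X Y"
proof -
  have "is_path C W X [Bwd s, Fwd g] Y"
    using assms Cod_obj by (auto simp: Hom_def)
  from loc_class_Hom[OF this] show ?thesis
    using assms by (simp add: roof_def Hom_def)
qed

lemma loc_functor_Hom: "f \<in> Hom C X Y \<Longrightarrow> loc_functor C W f \<in> Hom (localization C W) X Y"
  using loc_class_Hom[of W X "[Fwd f]" Y] Cod_obj by (auto simp: loc_functor_def Hom_def)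

text \<open>Both \<open>s\<close> and \<open>s \<cdot> t\<close> become invertible in the
  localization, so the inverse of \<open>s\<close> equals the image of \<open>t\<close> after the
  inverse of \<open>s \<cdot> t\<close>. Composing with the image of \<open>g\<close> identifies the
  two roofs.\<close>

lemma roof_refine:
  assumes s: "s \<in> W" "s \<in> Hom C L X" and g: "g \<in> Hom C L Y" and t: "t \<in> Hom C M L"
    and st: "s \<cdot> t \<in> W"
  shows "roof C W (s \<cdot> t) (g \<cdot> t) = roof C W s g"
proof -
  let ?D = "localization C W" and ?F = "loc_functor C W"
  interpret D: category ?D by (rule category_localization)
  note stH = comp_Hom[OF t s(2)]
  have inv: "loc_class C W X L [Bwd s] \<in> Hom ?D X L"
    "loc_class C W X M [Bwd (s \<cdot> t)] \<in> Hom ?D X M"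
    using s st stH Dom_obj by (auto simp: Hom_def intro!: loc_class_Hom[unfolded Hom_def, simplified])
  note FH = loc_functor_Hom[OF s(2), of W] loc_functor_Hom[OF g, of W] loc_functor_Hom[OF t, of W]
    loc_functor_Hom[OF stH, of W]
  let ?Bs = "loc_class C W X L [Bwd s]" and ?Bst = "loc_class C W X M [Bwd (s \<cdot> t)]"
  \<comment> \<open>The identity of \<open>X\<close> is inserted as \<open>?F (s \<cdot> t)\<close>
    after its formal inverse. Once \<open>?F (s \<cdot> t)\<close> is split, \<open>?Bs\<close>
    cancels \<open>?F s\<close>.\<close>
  have "?Bs = ?Bs \<cdot>\<^bsub>?D\<^esub> (?F (s \<cdot> t) \<cdot>\<^bsub>?D\<^esub> ?Bst)"
    using loc_functor_inverse(2)[OF st stH] D.comp_ident_right[OF inv(1)] by simp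
  also have "\<dots> = (?Bs \<cdot>\<^bsub>?D\<^esub> (?F s \<cdot>\<^bsub>?D\<^esub> ?F t)) \<cdot>\<^bsub>?D\<^esub> ?Bst"
    using D.comp_assoc[OF inv(2) FH(4) inv(1)] loc_functor_comp[OF t s(2)] by simp
  also have "\<dots> = ?F t \<cdot>\<^bsub>?D\<^esub> ?Bst"
    using D.comp_assoc[OF FH(3) FH(1) inv(1)] loc_functor_inverse(1)[OF s] D.comp_ident_left[OF FH(3)]
    by simp
  finally have "?F g \<cdot>\<^bsub>?D\<^esub> ?Bs = ?F (g \<cdot> t) \<cdot>\<^bsub>?D\<^esub> ?Bst"
    using D.comp_assoc[OF inv(2) FH(3) FH(2)] loc_functor_comp[OF t g] by simp
  then show ?thesis
    using roof_eq[OF s g] roof_eq[OF st stH comp_Hom[OF t g]] by simp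
qed

section \<open>Cancellation rules for monic, epic and invertible arrows\<close>

lemma monic_cancel:
  assumes "monic C m" "m \<in> Hom C X Y" "u \<in> Hom C W X" "v \<in> Hom C W X" "m \<cdot> u = m \<cdot> v"
  shows "u = v"
  using assms unfolding monic_def Hom_def by blast

lemma epic_cancel:
  assumes "epic C e" "e \<in> Hom C X Y" "u \<in> Hom C Y W" "v \<in> Hom C Y W" "u \<cdot> e = v \<cdot> e"
  shows "u = v"
  using assms unfolding epic_def Hom_def by blast

lemma iso_arrI:
  assumes "f \<in> Hom C X Y" "g \<in> Hom C Y X" "g \<cdot> f = ident C X" "f \<cdot> g = ident C Y"
  shows "iso_arr C f"
proof -
  have "f \<in> arr C" "Dom C f = X" "Cod C f = Y" using assms(1) by (simp_all add: Hom_def)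
  then show ?thesis unfolding iso_arr_def using assms(2-4) by auto
qed

end

section \<open>Kernels, cokernels and exactness\<close>

context preadditive_category
begin

section \<open>Universal properties of kernels and cokernels\<close>

lemma is_kernelD:
  assumes "is_kernel A f k" "f \<in> Hom A X Y"
  shows "k \<in> Hom A (Dom A k) X" "f \<cdot> k = hzero A (Dom A k) Y"
proof -
  have D: "Dom A f = X" "Cod A f = Y" using assms(2) by (simp_all add: Hom_def)
  note c = assms(1)[unfolded is_kernel_def D]
  show "k \<in> Hom A (Dom A k) X" "f \<cdot> k = hzero A (Dom A k) Y"
    using c[THEN conjunct2, THEN conjunct1] c[THEN conjunct2, THEN conjunct2, THEN conjunct1] .
qed

lemma is_kernel_factor:
  assumes "is_kernel A f k" "f \<in> Hom A X Y" "t \<in> Hom A W X" "f \<cdot> t = hzero A W Y"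
  obtains u where "u \<in> Hom A W (Dom A k)" "k \<cdot> u = t"
proof -
  have D: "Dom A f = X" "Cod A f = Y" using assms(2) by (simp_all add: Hom_def)
  have "\<exists>!u. u \<in> Hom A W (Dom A k) \<and> k \<cdot> u = t"
    using assms(1)[unfolded is_kernel_def D, THEN conjunct2, THEN conjunct2, THEN conjunct2] assms(3,4)
    by blast
  then show ?thesis using that by blast
qed

text \<open>Uniqueness in the universal property: \<open>f\<close> kills \<open>k \<cdot> u\<close>,
  and \<open>u\<close> and \<open>v\<close> are both factorizations of this arrow through
  \<open>k\<close>.\<close>

lemma is_kernel_monic:
  assumes "is_kernel A f k"
  shows "monic A k"
  unfolding monic_def
proof (intro conjI allI ballI impI)
  note k = is_kernelD[OF assms, of "Dom A f" "Cod A f"]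
  have f: "f \<in> Hom A (Dom A f) (Cod A f)" using assms by (simp add: is_kernel_def Hom_def)
  show "k \<in> arr A" using k[OF f] by (simp add: Hom_def)
  fix W u v assume uv: "u \<in> Hom A W (Dom A k)" "v \<in> Hom A W (Dom A k)" "k \<cdot> u = k \<cdot> v"
  have "f \<cdot> (k \<cdot> u) = hzero A W (Cod A f)"
    using comp_assoc[OF uv(1) k(1)[OF f] f] k(2)[OF f] comp_hzero_left[OF uv(1)] Hom_obj[OF f] by simp
  moreover have "k \<cdot> u \<in> Hom A W (Dom A f)" using comp_Hom uv(1) k(1)[OF f] by blast
  ultimately have "\<exists>!w. w \<in> Hom A W (Dom A k) \<and> k \<cdot> w = k \<cdot> u"
    using assms[unfolded is_kernel_def, THEN conjunct2, THEN conjunct2, THEN conjunct2] by blast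
  then show "u = v" using uv(1,2) uv(3)[symmetric] by blast
qed

lemma is_cokernelD:
  assumes "is_cokernel A f p" "f \<in> Hom A X Y"
  shows "p \<in> Hom A Y (Cod A p)" "p \<cdot> f = hzero A X (Cod A p)"
proof -
  have D: "Dom A f = X" "Cod A f = Y" using assms(2) by (simp_all add: Hom_def)
  note c = assms(1)[unfolded is_cokernel_def D]
  show "p \<in> Hom A Y (Cod A p)" "p \<cdot> f = hzero A X (Cod A p)"
    using c[THEN conjunct2, THEN conjunct1] c[THEN conjunct2, THEN conjunct2, THEN conjunct1] .
qed

lemma is_cokernel_factor:
  assumes "is_cokernel A f p" "f \<in> Hom A X Y" "t \<in> Hom A Y W" "t \<cdot> f = hzero A X W"
  obtains u where "u \<in> Hom A (Cod A p) W" "u \<cdot> p = t"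
proof -
  have D: "Dom A f = X" "Cod A f = Y" using assms(2) by (simp_all add: Hom_def)
  have "\<exists>!u. u \<in> Hom A (Cod A p) W \<and> u \<cdot> p = t"
    using assms(1)[unfolded is_cokernel_def D, THEN conjunct2, THEN conjunct2, THEN conjunct2] assms(3,4)
    by blast
  then show ?thesis using that by blast
qed

lemma is_cokernel_epic:
  assumes "is_cokernel A f p"
  shows "epic A p"
  unfolding epic_def
proof (intro conjI allI ballI impI)
  note p = is_cokernelD[OF assms, of "Dom A f" "Cod A f"]
  have f: "f \<in> Hom A (Dom A f) (Cod A f)" using assms by (simp add: is_cokernel_def Hom_def)
  show "p \<in> arr A" using p[OF f] by (simp add: Hom_def)
  fix W u v assume uv: "u \<in> Hom A (Cod A p) W" "v \<in> Hom A (Cod A p) W" "u \<cdot> p = v \<cdot> p"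
  have "(u \<cdot> p) \<cdot> f = hzero A (Dom A f) W"
    using comp_assoc[OF f p(1)[OF f] uv(1)] p(2)[OF f] comp_hzero_right[OF uv(1)] Hom_obj[OF f] by simp
  moreover have "u \<cdot> p \<in> Hom A (Cod A f) W" using comp_Hom uv(1) p(1)[OF f] by blast
  ultimately have "\<exists>!w. w \<in> Hom A (Cod A p) W \<and> w \<cdot> p = u \<cdot> p"
    using assms[unfolded is_cokernel_def, THEN conjunct2, THEN conjunct2, THEN conjunct2] by blast
  then show "u = v" using uv(1,2) uv(3)[symmetric] by blast
qed

section \<open>Tests against zero arrows\<close>

lemma monic_zero:
  assumes "monic A m" "m \<in> Hom A X Y" "u \<in> Hom A W X" "m \<cdot> u = hzero A W Y"
  shows "u = hzero A W X"
proof -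
  have "X \<in> obj A" "W \<in> obj A" using Hom_obj assms(3) by auto
  then show ?thesis
    using monic_cancel[OF assms(1-3) hzero_Hom] comp_hzero_right[OF assms(2)] assms(4) by simp
qed

lemma epic_zero:
  assumes "epic A e" "e \<in> Hom A X Y" "u \<in> Hom A Y W" "u \<cdot> e = hzero A X W"
  shows "u = hzero A Y W"
proof -
  have "Y \<in> obj A" "W \<in> obj A" using Hom_obj assms(3) by auto
  then show ?thesis
    using epic_cancel[OF assms(1-3) hzero_Hom] comp_hzero_left[OF assms(2)] assms(4) by simp
qed

text \<open>If \<open>u \<cdot> e = v \<cdot> e\<close>, the difference of \<open>v\<close> and
  \<open>u\<close> kills \<open>e\<close>, so in an additive setting it is enough to test against
  zero.\<close>

lemma epicI:
  assumes e: "e \<in> Hom A X Y"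
    and z: "\<And>W t. t \<in> Hom A Y W \<Longrightarrow> t \<cdot> e = hzero A X W \<Longrightarrow> t = hzero A Y W"
  shows "epic A e"
  unfolding epic_def
proof (intro conjI allI ballI impI)
  show "e \<in> arr A" using e by (simp add: Hom_def)
  fix W u v
  assume "u \<in> Hom A (Cod A e) W" "v \<in> Hom A (Cod A e) W" and eq: "u \<cdot> e = v \<cdot> e"
  then have uv: "u \<in> Hom A Y W" "v \<in> Hom A Y W" using e by (simp_all add: Hom_def)
  note n = hneg[OF uv(1)]
  have "(u \<oplus> hneg u) \<cdot> e = (v \<oplus> hneg u) \<cdot> e"
    using comp_hplus_left[OF e uv(1) n(1)] comp_hplus_left[OF e uv(2) n(1)] eq by simp
  then have "v \<oplus> hneg u = hzero A Y W"
    using n(2) comp_hzero_left[OF e] Hom_obj[OF uv(1)] z[OF hplus_Hom[OF uv(2) n(1)]] by simp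
  then show "u = v"
    using hplus_cancel[OF n(1) uv] hplus_comm n uv by metis
qed

text \<open>Zero objects enter the later arguments through the equation 1 = 0 on their identity: an
  arrow composed with that identity is both itself and zero.\<close>

lemma null_obj_Hom:
  assumes "ident A N = hzero A N N"
  shows "f \<in> Hom A N X \<Longrightarrow> f = hzero A N X" "f \<in> Hom A X N \<Longrightarrow> f = hzero A X N"
proof -
  show "f = hzero A N X" if f: "f \<in> Hom A N X"
    using comp_ident_right[OF f] comp_hzero_right[OF f] assms Hom_obj[OF f] by simp
  show "f = hzero A X N" if f: "f \<in> Hom A X N"
    using comp_ident_left[OF f] comp_hzero_left[OF f] assms Hom_obj[OF f] by simp
qed

lemma iso_arr_null:
  assumes "f \<in> Hom A X Y" "ident A X = hzero A X X" "ident A Y = hzero A Y Y"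
  shows "iso_arr A f"
proof -
  have o: "X \<in> obj A" "Y \<in> obj A" using Hom_obj assms(1) by auto
  show ?thesis
    using iso_arrI[OF assms(1) hzero_Hom[OF o(2,1)]] assms comp_hzero_left[OF assms(1) o(1)]
      comp_hzero_right[OF assms(1) o(2)] by simp
qed

end

context abelian_category
begin

section \<open>The chosen kernels, cokernels and zero object\<close>

lemma Ker: "f \<in> Hom A X Y \<Longrightarrow> is_kernel A f (Ker A f)"
  unfolding Ker_def by (rule someI_ex[OF ex_kernel]) (simp add: Hom_def)

lemma Coker: "f \<in> Hom A X Y \<Longrightarrow> is_cokernel A f (Coker A f)"
  unfolding Coker_def by (rule someI_ex[OF ex_cokernel]) (simp add: Hom_def)

lemma zero_ob: "zero_ob A \<in> obj A" "ident A (zero_ob A) = hzero A (zero_ob A) (zero_ob A)"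
proof -
  have "zero_object A (zero_ob A)" unfolding zero_ob_def by (rule someI_ex[OF ex_zero_object])
  then show "zero_ob A \<in> obj A" "ident A (zero_ob A) = hzero A (zero_ob A) (zero_ob A)"
    unfolding zero_object_def using ident_Hom hzero_Hom by blast+
qed

text \<open>A self-dual criterion free of images: whatever kills \<open>f\<close> also kills
  whatever \<open>g\<close> kills. Under exactness such a \<open>k\<close> factors through the
  image, which is the kernel of the cokernel of \<open>f\<close>, and such a \<open>t\<close>
  factors through that cokernel, so the composite vanishes. The converse tests with \<open>t\<close>
  the cokernel itself.\<close>

lemma exact_at_iff:
  assumes f: "f \<in> Hom A X Y" and g: "g \<in> Hom A Y Z"
  shows "exact_at A f g \<longleftrightarrow> g \<cdot> f = hzero A X Z \<and>
    (\<forall>V W. \<forall>k\<in>Hom A V Y. \<forall>t\<in>Hom A Y W. g \<cdot> k = hzero A V Z \<longrightarrow> t \<cdot> f = hzero A X W \<longrightarrow>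
      t \<cdot> k = hzero A V W)" (is "_ \<longleftrightarrow> ?zero \<and> ?mid")
proof -
  let ?q = "Coker A f" let ?m = "Ker A ?q"
  note q = Coker[OF f] and qH = is_cokernelD[OF Coker[OF f] f]
  note m = Ker[OF qH(1)] and mH = is_kernelD[OF Ker[OF qH(1)] qH(1)]
  have ex: "exact_at A f g \<longleftrightarrow> is_kernel A g ?m"
    using f g by (auto simp: exact_at_def Im_def Hom_def)
  show ?thesis
    unfolding ex
  proof
    assume gm: "is_kernel A g ?m"
    note gm0 = is_kernelD[OF gm g]
    obtain u where u: "u \<in> Hom A X (Dom A ?m)" "?m \<cdot> u = f"
      using is_kernel_factor[OF m qH(1) f qH(2)] .
    have "g \<cdot> f = hzero A X Z"
      using comp_assoc[OF u(1) gm0(1) g] gm0(2) u(2) comp_hzero_left[OF u(1)] Hom_obj[OF g] by simp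
    moreover have ?mid
    proof (intro allI ballI impI)
      fix V W k t
      assume k: "k \<in> Hom A V Y" "g \<cdot> k = hzero A V Z" and t: "t \<in> Hom A Y W" "t \<cdot> f = hzero A X W"
      obtain v where v: "v \<in> Hom A V (Dom A ?m)" "?m \<cdot> v = k"
        using is_kernel_factor[OF gm g k] .
      obtain w where w: "w \<in> Hom A (Cod A ?q) W" "w \<cdot> ?q = t"
        using is_cokernel_factor[OF q f t] .
      have "?q \<cdot> k = hzero A V (Cod A ?q)"
        using comp_assoc[OF v(1) mH(1) qH(1)] mH(2) v(2) comp_hzero_left[OF v(1)] Hom_obj[OF w(1)] by simp
      then show "t \<cdot> k = hzero A V W"
        using comp_assoc[OF k(1) qH(1) w(1)] w(2) comp_hzero_right[OF w(1)] Hom_obj[OF k(1)] by simp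
    qed
    ultimately show "?zero \<and> ?mid" by blast
  next
    assume *: "?zero \<and> ?mid"
    \<comment> \<open>Since \<open>g \<cdot> f\<close> is zero, \<open>g\<close> factors through the
      cokernel of \<open>f\<close> and hence kills the image.\<close>
    obtain w where w: "w \<in> Hom A (Cod A ?q) Z" "w \<cdot> ?q = g"
      using is_cokernel_factor[OF q f g] * by blast
    have "g \<cdot> ?m = hzero A (Dom A ?m) Z"
      using comp_assoc[OF mH(1) qH(1) w(1)] w(2) mH(2) comp_hzero_right[OF w(1)] Hom_obj[OF mH(1)] by simp
    moreover have "\<exists>!u. u \<in> Hom A V (Dom A ?m) \<and> ?m \<cdot> u = k"
      if k: "k \<in> Hom A V Y" "g \<cdot> k = hzero A V Z" for V k
    proof -
      \<comment> \<open>The criterion is applied with \<open>t\<close> equal to \<open>?q\<close>,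
        so \<open>k\<close> factors through the image.\<close>
      have "?q \<cdot> k = hzero A V (Cod A ?q)" using * k qH by blast
      then show ?thesis
        using is_kernel_factor[OF m qH(1) k(1)] monic_cancel[OF is_kernel_monic[OF m] mH(1)] by metis
    qed
    moreover have gD: "Dom A g = Y" "Cod A g = Z" and gA: "g \<in> arr A"
      using g by (simp_all add: Hom_def)
    ultimately show "is_kernel A g ?m"
      unfolding is_kernel_def gD using gA mH(1) by blast
  qed
qed

lemma exact_at_null:
  assumes "f \<in> Hom A X Y" "g \<in> Hom A Y Z" "ident A Y = hzero A Y Y"
  shows "exact_at A f g"
  unfolding exact_at_iff[OF assms(1,2)]
proof (intro conjI allI ballI impI)
  have 0: "k = hzero A V Y" "t \<cdot> k = hzero A V W" if "k \<in> Hom A V Y" "t \<in> Hom A Y W" for V W k t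
    using null_obj_Hom(2)[OF assms(3) that(1)] comp_hzero_right[OF that(2)] Hom_obj[OF that(1)]
    by simp_all
  show "g \<cdot> f = hzero A X Z" by (rule 0(2)[OF assms(1,2)])
  show "t \<cdot> k = hzero A V W" if "k \<in> Hom A V Y" "t \<in> Hom A Y W" for V W k t
    by (rule 0(2)[OF that])
qed

lemma exact_at_monic:
  assumes "monic A m" "m \<in> Hom A X Y"
  shows "exact_at A (hzero A (zero_ob A) X) m"
proof -
  have o: "X \<in> obj A" using Hom_obj assms by blast
  show ?thesis
    unfolding exact_at_iff[OF hzero_Hom[OF zero_ob(1) o] assms(2)]
  proof (intro conjI allI ballI impI)
    show "m \<cdot> hzero A (zero_ob A) X = hzero A (zero_ob A) Y"
      by (rule comp_hzero_right[OF assms(2) zero_ob(1)])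
    fix V W k t
    assume k: "k \<in> Hom A V X" "m \<cdot> k = hzero A V Y" and t: "t \<in> Hom A X W"
    show "t \<cdot> k = hzero A V W"
      using monic_zero[OF assms k] comp_hzero_right[OF t] Hom_obj[OF k(1)] by simp
  qed
qed

lemma exact_at_epic_iff:
  assumes "e \<in> Hom A X Y"
  shows "exact_at A e (hzero A Y (zero_ob A)) \<longleftrightarrow> epic A e"
proof -
  have o: "X \<in> obj A" "Y \<in> obj A" using Hom_obj assms by auto
  note z = hzero_Hom[OF o(2) zero_ob(1)]
  show ?thesis
  proof
    assume e: "epic A e"
    show "exact_at A e (hzero A Y (zero_ob A))"
      unfolding exact_at_iff[OF assms z]
    proof (intro conjI allI ballI impI)
      show "hzero A Y (zero_ob A) \<cdot> e = hzero A X (zero_ob A)"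
        by (rule comp_hzero_left[OF assms zero_ob(1)])
      fix V W k t
      assume k: "k \<in> Hom A V Y" and t: "t \<in> Hom A Y W" "t \<cdot> e = hzero A X W"
      show "t \<cdot> k = hzero A V W"
        using epic_zero[OF e assms t] comp_hzero_left[OF k] Hom_obj[OF t(1)] by simp
    qed
  next
    assume ex: "exact_at A e (hzero A Y (zero_ob A))"
    show "epic A e"
    proof (rule epicI[OF assms])
      fix W t assume t: "t \<in> Hom A Y W" "t \<cdot> e = hzero A X W"
      \<comment> \<open>The test arrow \<open>k\<close> is the identity of \<open>Y\<close>, which
        lies in the kernel of the zero arrow.\<close>
      then have "t \<cdot> ident A Y = hzero A Y W"
        using ex[unfolded exact_at_iff[OF assms z]] ident_Hom[OF o(2)] comp_ident_right[OF z] by blast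
      then show "t = hzero A Y W" using comp_ident_right[OF t(1)] by simp
    qed
  qed
qed

lemma exact_at_cokernel:
  assumes "is_cokernel A f p" "f \<in> Hom A X Y" "p \<in> Hom A Y Z"
  shows "exact_at A f p"
  unfolding exact_at_iff[OF assms(2,3)]
proof (intro conjI allI ballI impI)
  have Z: "Cod A p = Z" using assms(3) by (simp add: Hom_def)
  show "p \<cdot> f = hzero A X Z" using is_cokernelD[OF assms(1,2)] Z by simp
  fix V W k t
  assume k: "k \<in> Hom A V Y" "p \<cdot> k = hzero A V Z" and t: "t \<in> Hom A Y W" "t \<cdot> f = hzero A X W"
  obtain w where w: "w \<in> Hom A Z W" "w \<cdot> p = t"
    using is_cokernel_factor[OF assms(1,2) t] Z by auto
  show "t \<cdot> k = hzero A V W"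
    using comp_assoc[OF k(1) assms(3) w(1)] w(2) k(2) comp_hzero_right[OF w(1)] Hom_obj[OF k(1)] by simp
qed

text \<open>An epic \<open>e\<close> is the cokernel of some \<open>g\<close>. Since
  \<open>e\<close> kills \<open>g\<close>, exactness makes every \<open>t\<close> that kills
  \<open>f\<close> kill \<open>g\<close> too, so \<open>t\<close> factors through
  \<open>e\<close>.\<close>

lemma is_cokernel_exact_epic:
  assumes ex: "exact_at A f e" and f: "f \<in> Hom A X Y" and e: "e \<in> Hom A Y Z" and ep: "epic A e"
  shows "is_cokernel A f e"
proof -
  note x = ex[unfolded exact_at_iff[OF f e]]
  have Z: "Cod A e = Z" using e by (simp add: Hom_def)
  obtain g where g: "is_cokernel A g e" using epic_is_cokernel[OF ep] by blast
  then have gH: "g \<in> Hom A (Dom A g) Y"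
    using e by (simp add: is_cokernel_def Hom_def)
  have "\<exists>!u. u \<in> Hom A Z W \<and> u \<cdot> e = t" if t: "t \<in> Hom A Y W" "t \<cdot> f = hzero A X W" for W t
  proof -
    have "t \<cdot> g = hzero A (Dom A g) W"
      using x[THEN conjunct2, rule_format, OF gH t(1)] t(2) is_cokernelD(2)[OF g gH] Z by simp
    then show ?thesis
      using is_cokernel_factor[OF g gH t(1)] epic_cancel[OF ep e] Z by metis
  qed
  moreover have fD: "Dom A f = X" "Cod A f = Y" and "f \<in> arr A"
    using f by (simp_all add: Hom_def)
  ultimately show ?thesis
    unfolding is_cokernel_def fD Z using x e by blast
qed

text \<open>The monic \<open>m\<close> is the kernel of some \<open>g\<close>. As
  \<open>g \<cdot> m\<close> is zero, \<open>g\<close> factors through \<open>p\<close>, so it kills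
  whatever \<open>p\<close> kills, and the universal property of \<open>m\<close> applies.\<close>

lemma monic_kernel_of_cokernel:
  assumes m: "monic A m" "m \<in> Hom A X Y" and p: "is_cokernel A m p"
    and k: "k \<in> Hom A W Y" "p \<cdot> k = hzero A W (Cod A p)"
  obtains u where "u \<in> Hom A W X" "m \<cdot> u = k"
proof -
  obtain g where g: "is_kernel A g m" using monic_is_kernel[OF m(1)] by blast
  have D: "Dom A m = X" using m(2) by (simp add: Hom_def)
  have gH: "g \<in> Hom A Y (Cod A g)"
    using g m(2) by (simp add: is_kernel_def Hom_def)
  have "g \<cdot> m = hzero A X (Cod A g)" using is_kernelD(2)[OF g gH] D by simp
  then obtain v where v: "v \<in> Hom A (Cod A p) (Cod A g)" "v \<cdot> p = g"
    using is_cokernel_factor[OF p m(2) gH] by blast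
  have "g \<cdot> k = hzero A W (Cod A g)"
    using comp_assoc[OF k(1) is_cokernelD(1)[OF p m(2)] v(1)] v(2) k(2) comp_hzero_right[OF v(1)]
      Hom_obj[OF k(1)] by simp
  then show ?thesis using is_kernel_factor[OF g gH k(1)] D that by blast
qed

text \<open>
  If \<open>v u = 0\<close>, then \<open>f\<close> factors through the monomorphism \<open>k (Ker v)\<close>. By exactness \<open>k\<close> does too, so
  \<open>Ker v\<close> has a right inverse and \<open>v = 0\<close>.
\<close>

lemma exact_lift_epic:
  assumes f: "f \<in> Hom A X Y" and g: "g \<in> Hom A Y Z" and ex: "exact_at A f g"
    and k: "is_kernel A g k" and u: "u \<in> Hom A X (Dom A k)" "k \<cdot> u = f"
  shows "epic A u"
proof (rule epicI[OF u(1)])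
  fix W v assume v: "v \<in> Hom A (Dom A k) W" "v \<cdot> u = hzero A X W"
  note kH = is_kernelD[OF k g] and x = ex[unfolded exact_at_iff[OF f g]]
  let ?m = "Ker A v" let ?km = "k \<cdot> ?m"
  note m = Ker[OF v(1)] note mH = is_kernelD[OF m v(1)]
  note kmH = comp_Hom[OF mH(1) kH(1)]
  obtain w where w: "w \<in> Hom A X (Dom A ?m)" "?m \<cdot> w = u"
    using is_kernel_factor[OF m v(1) u(1) v(2)] .
  have mono: "monic A ?km"
    unfolding monic_def
  proof (intro conjI allI ballI impI)
    show "?km \<in> arr A" using kmH by (simp add: Hom_def)
    fix V a b assume "a \<in> Hom A V (Dom A ?km)" "b \<in> Hom A V (Dom A ?km)" and eq: "?km \<cdot> a = ?km \<cdot> b"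
    then have ab: "a \<in> Hom A V (Dom A ?m)" "b \<in> Hom A V (Dom A ?m)" using kmH by (simp_all add: Hom_def)
    have "k \<cdot> (?m \<cdot> a) = k \<cdot> (?m \<cdot> b)"
      using eq comp_assoc[OF ab(1) mH(1) kH(1)] comp_assoc[OF ab(2) mH(1) kH(1)] by simp
    then have "?m \<cdot> a = ?m \<cdot> b"
      using monic_cancel[OF is_kernel_monic[OF k] kH(1)] comp_Hom ab mH(1) by blast
    then show "a = b" using monic_cancel[OF is_kernel_monic[OF m] mH(1) ab] by simp
  qed
  let ?q = "Coker A ?km"
  note q = Coker[OF kmH] note qH = is_cokernelD[OF q kmH]
  have "?q \<cdot> f = hzero A X (Cod A ?q)"
  proof -
    have "?km \<cdot> w = f" using comp_assoc[OF w(1) mH(1) kH(1)] w(2) u(2) by simp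
    then show ?thesis
      using comp_assoc[OF w(1) kmH qH(1)] qH(2) comp_hzero_left[OF w(1)] Hom_obj[OF qH(1)] by simp
  qed
  \<comment> \<open>The criterion \<open>exact_at_iff\<close> with test arrows \<open>k\<close> and
    \<open>?q\<close>: \<open>g\<close> kills \<open>k\<close>, and \<open>?q\<close> kills
    \<open>f\<close>.\<close>
  then have "?q \<cdot> k = hzero A (Dom A k) (Cod A ?q)" using x kH qH(1) by blast
  then obtain y where y: "y \<in> Hom A (Dom A k) (Dom A ?m)" "?km \<cdot> y = k"
    using monic_kernel_of_cokernel[OF mono kmH q kH(1)] by blast
  have K: "Dom A k \<in> obj A" using Hom_obj kH(1) by blast
  have "k \<cdot> (?m \<cdot> y) = k \<cdot> ident A (Dom A k)"
    using y comp_assoc[OF y(1) mH(1) kH(1)] comp_ident_right[OF kH(1)] by simp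
  then have "?m \<cdot> y = ident A (Dom A k)"
    using monic_cancel[OF is_kernel_monic[OF k] kH(1) comp_Hom[OF y(1) mH(1)] ident_Hom[OF K]] by simp
  then have "v = (v \<cdot> ?m) \<cdot> y"
    using comp_assoc[OF y(1) mH(1) v(1)] comp_ident_right[OF v(1)] by simp
  then show "v = hzero A (Dom A k) W"
    using mH(2) comp_hzero_left[OF y(1)] Hom_obj[OF v(1)] by simp
qed

section \<open>Cohomology\<close>

lemma cocyc:
  assumes "is_complex A X"
  shows "is_kernel A (diff X n) (cocyc A X n)"
    and "cocyc A X n \<in> Hom A (Dom A (cocyc A X n)) (ob X n)"
    and "diff X n \<cdot> cocyc A X n = hzero A (Dom A (cocyc A X n)) (ob X (n + 1))"
    and "monic A (cocyc A X n)"
proof -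
  note d = complexD(2)[OF assms, of n]
  show k: "is_kernel A (diff X n) (cocyc A X n)" unfolding cocyc_def by (rule Ker[OF d])
  show "cocyc A X n \<in> Hom A (Dom A (cocyc A X n)) (ob X n)"
    "diff X n \<cdot> cocyc A X n = hzero A (Dom A (cocyc A X n)) (ob X (n + 1))"
    using is_kernelD[OF k d] .
  show "monic A (cocyc A X n)" by (rule is_kernel_monic[OF k])
qed

lemma complex_diff_diff:
  assumes "is_complex A X"
  shows "diff X n \<cdot> diff X (n - 1) = hzero A (ob X (n - 1)) (ob X (n + 1))"
proof -
  have "diff X (n - 1 + 1) \<cdot> diff X (n - 1) = hzero A (ob X (n - 1)) (ob X (n - 1 + 1 + 1))"
    using assms unfolding is_complex_def by blast
  then show ?thesis by simp
qed

text \<open>The description in \<open>bd_lift\<close> is well defined: a factorization exists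
  because the differential squares to zero, and it is unique because the inclusion of cocycles is
  monic.\<close>

lemma bd_lift:
  assumes X: "is_complex A X"
  shows "bd_lift A X n \<in> Hom A (ob X (n - 1)) (Dom A (cocyc A X n))"
    and "cocyc A X n \<cdot> bd_lift A X n = diff X (n - 1)"
proof -
  note k = cocyc[OF X, of n]
  have "\<exists>!u. u \<in> Hom A (ob X (n - 1)) (Dom A (cocyc A X n)) \<and> cocyc A X n \<cdot> u = diff X (n - 1)"
    using is_kernel_factor[OF k(1) complexD(2)[OF X] complexD(3)[OF X] complex_diff_diff[OF X]]
      monic_cancel[OF k(4,2)] by metis
  from theI'[OF this] show "bd_lift A X n \<in> Hom A (ob X (n - 1)) (Dom A (cocyc A X n))"
    "cocyc A X n \<cdot> bd_lift A X n = diff X (n - 1)"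
    unfolding bd_lift_def by simp_all
qed

lemma coh_proj:
  assumes X: "is_complex A X"
  shows "is_cokernel A (bd_lift A X n) (coh_proj A X n)"
    and "coh_proj A X n \<in> Hom A (Dom A (cocyc A X n)) (coh A X n)"
    and "coh_proj A X n \<cdot> bd_lift A X n = hzero A (ob X (n - 1)) (coh A X n)"
    and "epic A (coh_proj A X n)"
proof -
  note u = bd_lift(1)[OF X, of n]
  show p: "is_cokernel A (bd_lift A X n) (coh_proj A X n)"
    unfolding coh_proj_def by (rule Coker[OF u])
  show "coh_proj A X n \<in> Hom A (Dom A (cocyc A X n)) (coh A X n)"
    "coh_proj A X n \<cdot> bd_lift A X n = hzero A (ob X (n - 1)) (coh A X n)"
    using is_cokernelD[OF p u] unfolding coh_def by simp_all
  show "epic A (coh_proj A X n)" by (rule is_cokernel_epic[OF p])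
qed

lemma cocyc_map:
  assumes X: "is_complex A X" and Y: "is_complex A Y" and f: "chain_map A X Y f"
  shows "cocyc_map A X Y f n \<in> Hom A (Dom A (cocyc A X n)) (Dom A (cocyc A Y n))"
    and "cocyc A Y n \<cdot> cocyc_map A X Y f n = f n \<cdot> cocyc A X n"
proof -
  note k = cocyc[OF X, of n] and l = cocyc[OF Y, of n] and fn = chain_mapD[OF f]
  note d = complexD(2)[OF X, of n] complexD(2)[OF Y, of n]
  have "diff Y n \<cdot> (f n \<cdot> cocyc A X n) = f (n + 1) \<cdot> (diff X n \<cdot> cocyc A X n)"
    using comp_assoc[OF k(2) fn(1) d(2)] comp_assoc[OF k(2) d(1) fn(1)] fn(2)[of n] by simp
  also have "\<dots> = hzero A (Dom A (cocyc A X n)) (ob Y (n + 1))"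
    using k(3) comp_hzero_right[OF fn(1)] Hom_obj[OF k(2)] by simp
  finally have "\<exists>!z. z \<in> Hom A (Dom A (cocyc A X n)) (Dom A (cocyc A Y n)) \<and>
      cocyc A Y n \<cdot> z = f n \<cdot> cocyc A X n"
    using is_kernel_factor[OF l(1) d(2) comp_Hom[OF k(2) fn(1)]] monic_cancel[OF l(4,2)] by metis
  from theI'[OF this] show
    "cocyc_map A X Y f n \<in> Hom A (Dom A (cocyc A X n)) (Dom A (cocyc A Y n))"
    "cocyc A Y n \<cdot> cocyc_map A X Y f n = f n \<cdot> cocyc A X n"
    unfolding cocyc_map_def by simp_all
qed

lemma coh_map:
  assumes X: "is_complex A X" and Y: "is_complex A Y" and f: "chain_map A X Y f"
  shows "coh_map A X Y f n \<in> Hom A (coh A X n) (coh A Y n)"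
    and "coh_map A X Y f n \<cdot> coh_proj A X n = coh_proj A Y n \<cdot> cocyc_map A X Y f n"
proof -
  note k = cocyc[OF X, of n] and l = cocyc[OF Y, of n] and z = cocyc_map[OF X Y f, of n]
  note u = bd_lift[OF X, of n] and v = bd_lift[OF Y, of n]
  note p = coh_proj[OF X, of n] and q = coh_proj[OF Y, of n]
  have f': "f (n - 1) \<in> Hom A (ob X (n - 1)) (ob Y (n - 1))" "f n \<in> Hom A (ob X n) (ob Y n)"
    "f n \<cdot> diff X (n - 1) = diff Y (n - 1) \<cdot> f (n - 1)"
    using chain_mapD(1)[OF f] chain_mapD(2)[OF f, of "n - 1"] by simp_all
  let ?z = "cocyc_map A X Y f n"
  \<comment> \<open>The map on cocycles carries boundaries to boundaries. This is checked after the
    monic inclusion \<open>cocyc A Y n\<close>, where it becomes the chain map equation.\<close>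
  have "cocyc A Y n \<cdot> (?z \<cdot> bd_lift A X n) = cocyc A Y n \<cdot> (bd_lift A Y n \<cdot> f (n - 1))"
    using comp_assoc[OF u(1) z(1) l(2)] comp_assoc[OF u(1) k(2) f'(2)]
      comp_assoc[OF f'(1) v(1) l(2)] z(2) u(2) v(2) f'(3) by simp
  then have "?z \<cdot> bd_lift A X n = bd_lift A Y n \<cdot> f (n - 1)"
    using monic_cancel[OF l(4,2)] comp_Hom u(1) z(1) v(1) f'(1) by blast
  then have "(coh_proj A Y n \<cdot> ?z) \<cdot> bd_lift A X n = hzero A (ob X (n - 1)) (coh A Y n)"
    using comp_assoc[OF u(1) z(1) q(2)] comp_assoc[OF f'(1) v(1) q(2)] q(3)
      comp_hzero_left[OF f'(1)] Hom_obj[OF q(2)] by simp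
  then obtain \<phi> where "\<phi> \<in> Hom A (coh A X n) (coh A Y n)"
    "\<phi> \<cdot> coh_proj A X n = coh_proj A Y n \<cdot> ?z"
    using is_cokernel_factor[OF p(1) u(1) comp_Hom[OF z(1) q(2)]] unfolding coh_def by blast
  then have "\<exists>!\<phi>. \<phi> \<in> Hom A (coh A X n) (coh A Y n) \<and>
      \<phi> \<cdot> coh_proj A X n = coh_proj A Y n \<cdot> ?z"
    using epic_cancel[OF p(4,2)] by metis
  from theI'[OF this] show "coh_map A X Y f n \<in> Hom A (coh A X n) (coh A Y n)"
    "coh_map A X Y f n \<cdot> coh_proj A X n = coh_proj A Y n \<cdot> ?z"
    unfolding coh_map_def by simp_all
qed

text \<open>By exactness the differential maps epically onto the cocycles, so the projection to
  cohomology is zero. It is also epic, hence its target is a zero object.\<close>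

lemma exact_coh_null:
  assumes X: "is_complex A X" and ex: "exact_at A (diff X (n - 1)) (diff X n)"
  shows "ident A (coh A X n) = hzero A (coh A X n) (coh A X n)"
proof -
  note p = coh_proj[OF X, of n] and u = bd_lift[OF X, of n]
  have "epic A (bd_lift A X n)"
    by (rule exact_lift_epic[OF complexD(3)[OF X] complexD(2)[OF X] ex cocyc(1)[OF X] u])
  then have "coh_proj A X n = hzero A (Dom A (cocyc A X n)) (coh A X n)"
    using epic_zero[OF _ u(1) p(2,3)] by simp
  moreover have "coh A X n \<in> obj A" using Hom_obj p(2) by blast
  ultimately show ?thesis
    using epic_zero[OF p(4,2) ident_Hom] comp_ident_left[OF p(2)] by simp
qed

text \<open>With zero outgoing differentials the cocycles are the whole objects, and the zero
  incoming differential of \<open>Y\<close> makes its cohomology \<open>ob Y n\<close>. The induced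
  map then compares two cokernels of the same differential of \<open>X\<close>.\<close>

lemma coh_map_iso_cokernel:
  assumes X: "is_complex A X" and Y: "is_complex A Y" and f: "chain_map A X Y f"
    and dX: "diff X n = hzero A (ob X n) (ob X (n + 1))"
    and dY: "diff Y n = hzero A (ob Y n) (ob Y (n + 1))"
      "diff Y (n - 1) = hzero A (ob Y (n - 1)) (ob Y n)"
    and cok: "is_cokernel A (diff X (n - 1)) (f n)"
  shows "iso_arr A (coh_map A X Y f n)"
proof -
  note k = cocyc[OF X, of n] and l = cocyc[OF Y, of n] and z = cocyc_map[OF X Y f, of n]
  note u = bd_lift[OF X, of n] and v = bd_lift[OF Y, of n]
  note p = coh_proj[OF X, of n] and q = coh_proj[OF Y, of n]
  note \<phi> = coh_map[OF X Y f, of n] and fn = chain_mapD(1)[OF f, of n]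
  let ?k = "cocyc A X n" and ?l = "cocyc A Y n" and ?z = "cocyc_map A X Y f n"
  let ?p = "coh_proj A X n" and ?q = "coh_proj A Y n" and ?\<phi> = "coh_map A X Y f n"
  have obs: "ob X n \<in> obj A" "ob Y n \<in> obj A" "Dom A ?k \<in> obj A" "Dom A ?l \<in> obj A"
    using Hom_obj k(2) l(2) by blast+
  \<comment> \<open>A zero outgoing differential lets the identity factor through the cocycles,
    which inverts their inclusion.\<close>
  have retr: "\<exists>a. a \<in> Hom A (ob Z n) (Dom A (cocyc A Z n)) \<and> cocyc A Z n \<cdot> a = ident A (ob Z n) \<and>
      a \<cdot> cocyc A Z n = ident A (Dom A (cocyc A Z n))"
    if Z: "is_complex A Z" and d: "diff Z n = hzero A (ob Z n) (ob Z (n + 1))" for Z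
  proof -
    note c = cocyc[OF Z, of n]
    have o: "ob Z n \<in> obj A" "Dom A (cocyc A Z n) \<in> obj A" using Hom_obj c(2) by blast+
    have "diff Z n \<cdot> ident A (ob Z n) = hzero A (ob Z n) (ob Z (n + 1))"
      using comp_ident_right[OF complexD(2)[OF Z], of n] d by simp
    then obtain a where a: "a \<in> Hom A (ob Z n) (Dom A (cocyc A Z n))" "cocyc A Z n \<cdot> a = ident A (ob Z n)"
      using is_kernel_factor[OF c(1) complexD(2)[OF Z] ident_Hom[OF o(1)]] by blast
    have "cocyc A Z n \<cdot> (a \<cdot> cocyc A Z n) = cocyc A Z n \<cdot> ident A (Dom A (cocyc A Z n))"
      using comp_assoc[OF c(2) a(1) c(2)] a(2) comp_ident_left[OF c(2)] comp_ident_right[OF c(2)] by simp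
    then have "a \<cdot> cocyc A Z n = ident A (Dom A (cocyc A Z n))"
      using monic_cancel[OF c(4,2) comp_Hom[OF c(2) a(1)] ident_Hom[OF o(2)]] by simp
    then show ?thesis using a by blast
  qed
  obtain a where a: "a \<in> Hom A (ob X n) (Dom A ?k)" "?k \<cdot> a = ident A (ob X n)" "a \<cdot> ?k = ident A (Dom A ?k)"
    using retr[OF X dX] by blast
  obtain b where b: "b \<in> Hom A (ob Y n) (Dom A ?l)" "?l \<cdot> b = ident A (ob Y n)" "b \<cdot> ?l = ident A (Dom A ?l)"
    using retr[OF Y dY(1)] by blast
  have "bd_lift A Y n = hzero A (ob Y (n - 1)) (Dom A ?l)"
    using monic_zero[OF l(4,2) v(1)] v(2) dY(2) by simp
  \<comment> \<open>\<open>Y\<close> has no boundaries in this degree, so the identity of its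
    cocycles descends along \<open>?q\<close>; this gives the left inverse \<open>r\<close>.\<close>
  then have "ident A (Dom A ?l) \<cdot> bd_lift A Y n = hzero A (ob Y (n - 1)) (Dom A ?l)"
    using comp_ident_left[OF v(1)] by simp
  then obtain r where r: "r \<in> Hom A (coh A Y n) (Dom A ?l)" "r \<cdot> ?q = ident A (Dom A ?l)"
    using is_cokernel_factor[OF q(1) v(1) ident_Hom[OF obs(4)]] unfolding coh_def by blast
  have d: "diff X (n - 1) \<in> Hom A (ob X (n - 1)) (ob X n)" by (rule complexD(3)[OF X])
  have "a \<cdot> diff X (n - 1) = bd_lift A X n"
    using comp_assoc[OF u(1) k(2) a(1)] u(2) a(3) comp_ident_left[OF u(1)] by simp
  then have "(?p \<cdot> a) \<cdot> diff X (n - 1) = hzero A (ob X (n - 1)) (coh A X n)"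
    using comp_assoc[OF d a(1) p(2)] p(3) by simp
  \<comment> \<open>The cokernel property of \<open>f n\<close> supplies the core of the inverse, an
    arrow from \<open>ob Y n\<close> to the cohomology of \<open>X\<close>.\<close>
  then obtain w where w: "w \<in> Hom A (ob Y n) (coh A X n)" "w \<cdot> f n = ?p \<cdot> a"
    using is_cokernel_factor[OF cok d comp_Hom[OF a(1) p(2)]] fn by (auto simp: Hom_def)
  \<comment> \<open>The inverse goes from the cohomology of \<open>Y\<close> by \<open>r\<close> to
    its cocycles, by \<open>?l\<close> to \<open>ob Y n\<close>, and by \<open>w\<close> to the
    cohomology of \<open>X\<close>. Both identities are checked after the epic projections
    \<open>?p\<close> and \<open>?q\<close>.\<close>
  let ?wl = "w \<cdot> ?l"
  note wl = comp_Hom[OF l(2) w(1)]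
  let ?\<psi> = "?wl \<cdot> r"
  note \<psi> = comp_Hom[OF r(1) wl]
  have \<psi>q: "?\<psi> \<cdot> ?q = ?wl"
    using comp_assoc[OF q(2) r(1) wl] r(2) comp_ident_right[OF wl] by simp
  have "(?\<psi> \<cdot> ?\<phi>) \<cdot> ?p = ?p"
  proof -
    have "(?\<psi> \<cdot> ?\<phi>) \<cdot> ?p = ?wl \<cdot> ?z"
      using comp_assoc[OF p(2) \<phi>(1) \<psi>] \<phi>(2) comp_assoc[OF z(1) q(2) \<psi>] \<psi>q by simp
    also have "\<dots> = (w \<cdot> f n) \<cdot> ?k"
      using comp_assoc[OF z(1) l(2) w(1)] z(2) comp_assoc[OF k(2) fn w(1)] by simp
    also have "\<dots> = ?p"
      using w(2) comp_assoc[OF k(2) a(1) p(2)] a(3) comp_ident_right[OF p(2)] by simp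
    finally show ?thesis .
  qed
  moreover have cX: "coh A X n \<in> obj A" and cY: "coh A Y n \<in> obj A"
    using Hom_obj \<phi>(1) by blast+
  ultimately have 1: "?\<psi> \<cdot> ?\<phi> = ident A (coh A X n)"
    using epic_cancel[OF p(4,2) comp_Hom[OF \<phi>(1) \<psi>] ident_Hom[OF cX]] comp_ident_left[OF p(2)] by simp
  have "?l \<cdot> (?z \<cdot> a) = ?l \<cdot> (b \<cdot> f n)"
    using comp_assoc[OF a(1) z(1) l(2)] z(2) comp_assoc[OF a(1) k(2) fn] a(2) comp_ident_right[OF fn]
      comp_assoc[OF fn b(1) l(2)] b(2) comp_ident_left[OF fn] by simp
  then have za: "?z \<cdot> a = b \<cdot> f n"
    using monic_cancel[OF l(4,2) comp_Hom[OF a(1) z(1)] comp_Hom[OF fn b(1)]] by simp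
  have "(?\<phi> \<cdot> w) \<cdot> f n = (?q \<cdot> b) \<cdot> f n"
    using comp_assoc[OF fn w(1) \<phi>(1)] w(2) comp_assoc[OF a(1) p(2) \<phi>(1)] \<phi>(2)
      comp_assoc[OF a(1) z(1) q(2)] za comp_assoc[OF fn b(1) q(2)] by simp
  then have \<phi>w: "?\<phi> \<cdot> w = ?q \<cdot> b"
    using epic_cancel[OF is_cokernel_epic[OF cok] fn comp_Hom[OF w(1) \<phi>(1)] comp_Hom[OF b(1) q(2)]] by simp
  have "(?\<phi> \<cdot> ?\<psi>) \<cdot> ?q = ?q"
    using comp_assoc[OF q(2) \<psi> \<phi>(1)] \<psi>q comp_assoc[OF l(2) w(1) \<phi>(1)] \<phi>w
      comp_assoc[OF l(2) b(1) q(2)] b(3) comp_ident_right[OF q(2)] by simp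
  then have "?\<phi> \<cdot> ?\<psi> = ident A (coh A Y n)"
    using epic_cancel[OF q(4,2) comp_Hom[OF \<psi> \<phi>(1)] ident_Hom[OF cY]] comp_ident_left[OF q(2)] by simp
  with 1 show ?thesis by (rule iso_arrI[OF \<phi>(1) \<psi>])
qed

section \<open>The roof of an exact sequence\<close>

lemma is_complex_hzero:
  assumes "\<And>n. ob X n \<in> obj A" "\<And>n. diff X n = hzero A (ob X n) (ob X (n + 1))"
  shows "is_complex A X"
  unfolding is_complex_def
  using assms hzero_Hom[OF assms(1) assms(1)] comp_hzero_left[OF hzero_Hom[OF assms(1) assms(1)] assms(1)]
  by simp

lemma stalk_simps:
  "ob (stalk A B) n = (if n = 0 then B else zero_ob A)"
  "diff (stalk A B) n = hzero A (ob (stalk A B) n) (ob (stalk A B) (n + 1))"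
  by (simp_all add: stalk_def Let_def)

lemma stalk_obj: "B \<in> obj A \<Longrightarrow> ob (stalk A B) n \<in> obj A"
  using zero_ob by (simp add: stalk_simps)

lemma is_complex_stalk: "B \<in> obj A \<Longrightarrow> is_complex A (stalk A B)"
  by (intro is_complex_hzero stalk_obj stalk_simps(2))

lemma shift_ob: "ob (shift A i X) n = ob X (n + i)"
  by (simp add: shift_def)

text \<open>The sign introduced by an odd shift is harmless, since the inverse of zero is
  zero.\<close>

lemma shift_stalk_diff:
  assumes "B \<in> obj A"
  shows "diff (shift A i (stalk A B)) n =
    hzero A (ob (shift A i (stalk A B)) n) (ob (shift A i (stalk A B)) (n + 1))"
proof -
  let ?X = "ob (stalk A B) (n + i)" and ?Y = "ob (stalk A B) (n + i + 1)"
  interpret comm_group "hom_group A ?X ?Y" by (rule hom_comm_group[OF stalk_obj stalk_obj, OF assms assms])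
  have n: "n + 1 + i = n + i + 1" by simp
  have "inv\<^bsub>hom_group A ?X ?Y\<^esub> hzero A ?X ?Y = hzero A ?X ?Y"
    using inv_one by (simp add: hom_group_def)
  then show ?thesis by (simp add: shift_def stalk_simps(2) n)
qed

lemma is_complex_shift_stalk: "B \<in> obj A \<Longrightarrow> is_complex A (shift A i (stalk A B))"
  by (intro is_complex_hzero shift_stalk_diff) (simp_all add: shift_ob stalk_obj)

section \<open>The apex complex and the legs of the Yoneda roof\<close>

lemma yoneda_complex_simps:
  "ob (yoneda_complex A i e) n =
    (if - int i \<le> n \<and> n \<le> 0 then Dom A (e (nat (- n))) else zero_ob A)"
  "diff (yoneda_complex A i e) n = (if - int i \<le> n \<and> n < 0 then e (nat (- n))
    else hzero A (ob (yoneda_complex A i e) n) (ob (yoneda_complex A i e) (n + 1)))"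
  by (simp_all add: yoneda_complex_def Let_def)

lemma exact_seq_arr:
  assumes "exact_seq A i e" "k \<le> i"
  shows "e k \<in> Hom A (Dom A (e k)) (Cod A (e k))"
    and "k < i \<Longrightarrow> Cod A (e (Suc k)) = Dom A (e k)"
  using assms unfolding exact_seq_def exact_at_def Hom_def by (cases "k = i"; auto)+

lemma exact_seq_epic: "exact_seq A i e \<Longrightarrow> epic A (e 0)"
  using exact_at_epic_iff exact_seq_arr(1)[of i e 0] by (simp add: exact_seq_def)

lemma yoneda_ob:
  assumes "exact_seq A i e"
  shows "ob (yoneda_complex A i e) n \<in> obj A"
  using Hom_obj[OF exact_seq_arr(1)[OF assms, of "nat (- n)"]] zero_ob(1)
  by (auto simp: yoneda_complex_simps)

lemma yoneda_diff:
  assumes "exact_seq A i e"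
  shows "diff (yoneda_complex A i e) n \<in>
    Hom A (ob (yoneda_complex A i e) n) (ob (yoneda_complex A i e) (n + 1))"
proof (cases "- int i \<le> n \<and> n < 0")
  case True
  \<comment> \<open>The index is offset by one: the differential leaving degree
    \<open>- (k + 1)\<close> is \<open>e (Suc k)\<close>, and it ends at the source of
    \<open>e k\<close>.\<close>
  define k where "k = nat (- n) - 1"
  have "nat (- n) = Suc k" "nat (- (n + 1)) = k" "k < i"
    using True unfolding k_def by linarith+
  then show ?thesis
    using exact_seq_arr(1)[OF assms, of "Suc k"] exact_seq_arr(2)[OF assms, of k] True
    by (simp add: yoneda_complex_simps)
next
  case False
  then show ?thesis
    using hzero_Hom[OF yoneda_ob yoneda_ob, OF assms assms, of n "n + 1"]
    by (subst yoneda_complex_simps(2)) auto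
qed

text \<open>In length 0 the incoming differential is the zero arrow out of the zero object, and the
  claim is exactness at the left end; otherwise that differential is \<open>e 1\<close>.\<close>

lemma yoneda_exact_0:
  assumes "exact_seq A i e"
  shows "exact_at A (diff (yoneda_complex A i e) (- 1)) (e 0)"
  using assms by (cases i) (auto simp: exact_seq_def yoneda_complex_simps)

text \<open>Degree 0 is the exception, because the complex stops before \<open>e 0\<close>. Inside
  the range the claim is exactness of the sequence; outside it the middle object is zero.\<close>

lemma yoneda_exact:
  assumes e: "exact_seq A i e" and n: "n \<noteq> 0"
  shows "exact_at A (diff (yoneda_complex A i e) (n - 1)) (diff (yoneda_complex A i e) n)"
proof (cases "- int i \<le> n \<and> n < 0")
  case True
  define k where "k = nat (- n)"
  have k: "n = - int k" "k \<le> i" "0 < k" using True unfolding k_def by linarith+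
  \<comment> \<open>For \<open>k = i\<close> the incoming differential is the zero arrow out of the
    zero object, so exactness at the left end is used.\<close>
  show ?thesis
  proof (cases "k = i")
    case True
    then show ?thesis using e k by (simp add: exact_seq_def yoneda_complex_simps)
  next
    case False
    have "nat (- (n - 1)) = Suc k" using k by simp
    then show ?thesis using e k False by (simp add: exact_seq_def yoneda_complex_simps)
  qed
next
  case False
  then have "ob (yoneda_complex A i e) n = zero_ob A" using n by (auto simp: yoneda_complex_simps)
  then show ?thesis
    using exact_at_null yoneda_diff[OF e, of "n - 1"] yoneda_diff[OF e, of n] zero_ob(2) by simp
qed

lemma is_complex_yoneda:
  assumes e: "exact_seq A i e"
  shows "is_complex A (yoneda_complex A i e)"
  unfolding is_complex_def
proof (intro conjI allI)
  let ?L = "yoneda_complex A i e"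
  fix n
  show "ob ?L n \<in> obj A" by (rule yoneda_ob[OF e])
  show "diff ?L n \<in> Hom A (ob ?L n) (ob ?L (n + 1))" by (rule yoneda_diff[OF e])
  show "diff ?L (n + 1) \<cdot> diff ?L n = hzero A (ob ?L n) (ob ?L (n + 1 + 1))"
  \<comment> \<open>Into degree 0 the outgoing differential is zero by definition; at every other
    middle degree the equation is part of exactness.\<close>
  proof (cases "n + 1 = 0")
    case True
    then have d: "diff ?L (n + 1) = hzero A (ob ?L (n + 1)) (ob ?L (n + 1 + 1))"
      by (subst yoneda_complex_simps(2)) simp
    show ?thesis unfolding d by (rule comp_hzero_left[OF yoneda_diff[OF e] yoneda_ob[OF e]])
  next
    case False
    have "exact_at A (diff ?L n) (diff ?L (n + 1))" using yoneda_exact[OF e False] by simp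
    then show ?thesis
      unfolding exact_at_iff[OF yoneda_diff[OF e] yoneda_diff[OF e]] by (rule conjunct1)
  qed
qed

lemma chain_map_yoneda_s:
  assumes e: "exact_seq A i e"
  shows "chain_map A (yoneda_complex A i e) (stalk A (Cod A (e 0))) (yoneda_s A i e)"
  unfolding chain_map_def
proof (intro conjI allI)
  let ?L = "yoneda_complex A i e" and ?C = "Cod A (e 0)"
  let ?S = "stalk A ?C"
  note e0 = exact_seq_arr(1)[OF e, of 0, simplified]
  have C: "?C \<in> obj A" using Hom_obj[OF e0] by blast
  note S = stalk_obj[OF C]
  have L0: "ob ?L 0 = Dom A (e 0)" "ob ?S 0 = ?C" by (simp_all add: yoneda_complex_simps stalk_simps)
  show sH: "yoneda_s A i e n \<in> Hom A (ob ?L n) (ob ?S n)" for n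
    using e0 L0 hzero_Hom[OF yoneda_ob[OF e] S, of n n] by (auto simp: yoneda_s_def)
  fix n
  \<comment> \<open>Both sides of the square are zero. Only for \<open>n = - 1\<close> does
    \<open>e 0\<close> occur, and there exactness at its source gives the vanishing.\<close>
  have "yoneda_s A i e (n + 1) \<cdot> diff ?L n = hzero A (ob ?L n) (ob ?S (n + 1))"
  proof (cases "n = - 1")
    case True
    have "e 0 \<cdot> diff ?L (- 1) = hzero A (ob ?L (- 1)) ?C"
      using yoneda_exact_0[OF e] exact_at_iff[of "diff ?L (- 1)" "ob ?L (- 1)" "ob ?L 0" "e 0" ?C]
        yoneda_diff[OF e, of "- 1"] e0 L0 by simp
    then show ?thesis using True L0 by (simp add: yoneda_s_def)
  next
    case False
    then show ?thesis
      using comp_hzero_left[OF yoneda_diff[OF e] S] by (simp add: yoneda_s_def)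
  qed
  also have "\<dots> = diff ?S n \<cdot> yoneda_s A i e n"
    unfolding stalk_simps(2)[of _ n] by (rule comp_hzero_left[OF sH S, symmetric])
  finally show "yoneda_s A i e (n + 1) \<cdot> diff ?L n = diff ?S n \<cdot> yoneda_s A i e n" .
qed

lemma chain_map_yoneda_g:
  assumes e: "exact_seq A i e"
  shows "chain_map A (yoneda_complex A i e) (shift A (int i) (stalk A (Dom A (e i)))) (yoneda_g A i e)"
  unfolding chain_map_def
proof (intro conjI allI)
  let ?L = "yoneda_complex A i e" and ?B = "Dom A (e i)"
  let ?S = "shift A (int i) (stalk A ?B)"
  have B: "?B \<in> obj A" using Hom_obj[OF exact_seq_arr(1)[OF e order_refl]] by blast
  have S: "ob ?S n \<in> obj A" for n using stalk_obj[OF B] by (simp add: shift_ob)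
  have Li: "ob ?L (- int i) = ?B" "ob ?S (- int i) = ?B"
    by (simp_all add: yoneda_complex_simps stalk_simps shift_ob)
  show gH: "yoneda_g A i e n \<in> Hom A (ob ?L n) (ob ?S n)" for n
    using ident_Hom[OF B] Li hzero_Hom[OF yoneda_ob[OF e] S, of n n] by (auto simp: yoneda_g_def)
  fix n
  \<comment> \<open>The identity of the leftmost object occurs only for
    \<open>n + 1 = - int i\<close>, where the differential entering that object is zero.\<close>
  have "yoneda_g A i e (n + 1) \<cdot> diff ?L n = hzero A (ob ?L n) (ob ?S (n + 1))"
  proof (cases "n + 1 = - int i")
    case True
    then have "diff ?L n = hzero A (ob ?L n) (ob ?L (n + 1))"
      by (subst yoneda_complex_simps(2)) simp
    then show ?thesis using comp_hzero_right[OF gH yoneda_ob[OF e]] by simp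
  next
    case False
    then show ?thesis
      using comp_hzero_left[OF yoneda_diff[OF e] S] by (simp add: yoneda_g_def)
  qed
  also have "\<dots> = diff ?S n \<cdot> yoneda_g A i e n"
    unfolding shift_stalk_diff[OF B, of _ n] by (rule comp_hzero_left[OF gH S, symmetric])
  finally show "yoneda_g A i e (n + 1) \<cdot> diff ?L n = diff ?S n \<cdot> yoneda_g A i e n" .
qed

text \<open>In degree 0 the arrow \<open>e 0\<close> is the cokernel of the preceding differential,
  so \<open>coh_map_iso_cokernel\<close> applies. In all other degrees both cohomology objects
  vanish.\<close>

lemma quasi_iso_yoneda_s:
  assumes e: "exact_seq A i e"
  shows "quasi_iso A (yoneda_complex A i e) (stalk A (Cod A (e 0))) (yoneda_s A i e)"
  unfolding quasi_iso_def
proof (intro conjI allI)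
  let ?L = "yoneda_complex A i e" and ?C = "Cod A (e 0)"
  let ?S = "stalk A ?C"
  note e0 = exact_seq_arr(1)[OF e, of 0, simplified]
  have C: "?C \<in> obj A" using Hom_obj[OF e0] by blast
  note L = is_complex_yoneda[OF e] and S = is_complex_stalk[OF C]
  show s: "chain_map A ?L ?S (yoneda_s A i e)" by (rule chain_map_yoneda_s[OF e])
  fix n
  show "iso_arr A (coh_map A ?L ?S (yoneda_s A i e) n)"
  proof (cases "n = 0")
    case True
    have D: "ob ?L 0 = Dom A (e 0)" by (simp add: yoneda_complex_simps)
    have "is_cokernel A (diff ?L (- 1)) (e 0)"
      using is_cokernel_exact_epic[OF yoneda_exact_0[OF e] _ e0 exact_seq_epic[OF e]]
        yoneda_diff[OF e, of "- 1"] D by simp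
    then have "is_cokernel A (diff ?L (n - 1)) (yoneda_s A i e n)"
      using True by (simp add: yoneda_s_def)
    moreover have "diff ?L n = hzero A (ob ?L n) (ob ?L (n + 1))"
      using True by (subst yoneda_complex_simps(2)) simp
    moreover have "diff ?S (n - 1) = hzero A (ob ?S (n - 1)) (ob ?S n)"
      using stalk_simps(2)[of ?C "n - 1"] by simp
    ultimately show ?thesis
      using coh_map_iso_cokernel[OF L S s _ stalk_simps(2)] by blast
  next
    case False
    have "ident A (ob ?S n) = hzero A (ob ?S n) (ob ?S n)"
      using False zero_ob(2) by (simp add: stalk_simps)
    then have "exact_at A (diff ?S (n - 1)) (diff ?S n)"
      using exact_at_null[OF complexD(3)[OF S] complexD(2)[OF S]] by blast
    then show ?thesis
      using iso_arr_null[OF coh_map(1)[OF L S s]] exact_coh_null[OF L yoneda_exact[OF e False]]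
        exact_coh_null[OF S] by blast
  qed
qed

lemma hclass_yoneda:
  assumes e: "exact_seq A i e"
  shows "hclass A (yoneda_complex A i e) (stalk A (Cod A (e 0))) (yoneda_s A i e) \<in> quasi_isos A"
    and "hclass A (yoneda_complex A i e) (stalk A (Cod A (e 0))) (yoneda_s A i e) \<in>
      Hom (homotopy_category A) (yoneda_complex A i e) (stalk A (Cod A (e 0)))"
    and "hclass A (yoneda_complex A i e) (shift A (int i) (stalk A (Dom A (e i)))) (yoneda_g A i e) \<in>
      Hom (homotopy_category A) (yoneda_complex A i e) (shift A (int i) (stalk A (Dom A (e i))))"
proof -
  have B: "Dom A (e i) \<in> obj A" using Hom_obj[OF exact_seq_arr(1)[OF e order_refl]] by blast
  have C: "Cod A (e 0) \<in> obj A" using Hom_obj[OF exact_seq_arr(1)[OF e le0]] by blast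
  note L = is_complex_yoneda[OF e] and cC = is_complex_stalk[OF C]
  show "hclass A (yoneda_complex A i e) (stalk A (Cod A (e 0))) (yoneda_s A i e) \<in> quasi_isos A"
    unfolding quasi_isos_def using L cC quasi_iso_yoneda_s[OF e] by blast
  show "hclass A (yoneda_complex A i e) (stalk A (Cod A (e 0))) (yoneda_s A i e) \<in>
      Hom (homotopy_category A) (yoneda_complex A i e) (stalk A (Cod A (e 0)))"
    by (rule hclass_Hom[OF L cC chain_map_yoneda_s[OF e]])
  show "hclass A (yoneda_complex A i e) (shift A (int i) (stalk A (Dom A (e i)))) (yoneda_g A i e) \<in>
      Hom (homotopy_category A) (yoneda_complex A i e) (shift A (int i) (stalk A (Dom A (e i))))"
    by (rule hclass_Hom[OF L is_complex_shift_stalk[OF B] chain_map_yoneda_g[OF e]])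
qed

lemma yoneda_class_Ext:
  assumes "exact_seq A i e"
  shows "yoneda_class A i e \<in> Ext A i (Cod A (e 0)) (Dom A (e i))"
  using category.roof_Hom[OF category_homotopy_category hclass_yoneda[OF assms]]
  by (simp add: Ext_def yoneda_class_def derived_category_def Let_def)

text \<open>A vanishing criterion: precomposing the roof with \<open>t\<close> keeps its class, and
  afterwards the right leg is the zero chain map.\<close>

lemma yoneda_class_zero:
  assumes e: "exact_seq A i e" and M: "is_complex A M"
    and t: "chain_map A M (yoneda_complex A i e) t"
    and st: "quasi_iso A M (stalk A (Cod A (e 0))) (\<lambda>n. yoneda_s A i e n \<cdot> t n)"
    and gt: "\<And>n. yoneda_g A i e n \<cdot> t n =
      hzero A (ob M n) (ob (shift A (int i) (stalk A (Dom A (e i)))) n)"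
  shows "yoneda_class A i e = Ext_zero A i (Cod A (e 0)) (Dom A (e i))"
proof -
  let ?K = "homotopy_category A" and ?W = "quasi_isos A" and ?D = "derived_category A"
  let ?L = "yoneda_complex A i e" and ?SC = "stalk A (Cod A (e 0))"
    and ?SB = "shift A (int i) (stalk A (Dom A (e i)))"
  interpret K: category ?K by (rule category_homotopy_category)
  have B: "is_complex A ?SB"
    using Hom_obj[OF exact_seq_arr(1)[OF e order_refl]] is_complex_shift_stalk by blast
  have C: "is_complex A ?SC"
    using Hom_obj[OF exact_seq_arr(1)[OF e le0]] is_complex_stalk by blast
  note L = is_complex_yoneda[OF e] and h = hclass_yoneda[OF e]
  let ?s = "hclass A ?L ?SC (yoneda_s A i e)" and ?g = "hclass A ?L ?SB (yoneda_g A i e)"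
    and ?t = "hclass A M ?L t"
  let ?s' = "?s \<cdot>\<^bsub>?K\<^esub> ?t"
  have tH: "?t \<in> Hom ?K M ?L" by (rule hclass_Hom[OF M L t])
  have s': "?s' \<in> ?W"
    unfolding hclass_comp[OF M L C t chain_map_yoneda_s[OF e]] quasi_isos_def using M C st by blast
  have s'H: "?s' \<in> Hom ?K M ?SC" by (rule K.comp_Hom[OF tH h(2)])
  have g': "?g \<cdot>\<^bsub>?K\<^esub> ?t = hclass A M ?SB (\<lambda>n. hzero A (ob M n) (ob ?SB n))"
    unfolding hclass_comp[OF M L B t chain_map_yoneda_g[OF e]] gt ..
  have bwd: "loc_class ?K ?W ?SC M [Bwd ?s'] \<in> Hom ?D ?SC M"
    unfolding derived_category_def
    by (rule K.loc_class_Hom) (use s' s'H M in \<open>simp add: Hom_def homotopy_category_def\<close>)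
  have "yoneda_class A i e = roof ?K ?W ?s' (?g \<cdot>\<^bsub>?K\<^esub> ?t)"
    using K.roof_refine[OF h tH s'] by (simp add: yoneda_class_def Let_def)
  also have "\<dots> = derived_zero A M ?SB \<cdot>\<^bsub>?D\<^esub> loc_class ?K ?W ?SC M [Bwd ?s']"
    using K.roof_eq[OF s' s'H K.comp_Hom[OF tH h(3)]]
    by (simp add: g' derived_zero_def derived_category_def)
  \<comment> \<open>\<open>derived_zero\<close> absorbs the formal inverse of the left leg.\<close>
  also have "\<dots> = Ext_zero A i (Cod A (e 0)) (Dom A (e i))"
    unfolding Ext_zero_def by (rule derived_zero_comp(2)[OF bwd B])
  finally show ?thesis .
qed

section \<open>Filtrations of length two\<close>

text \<open>This presents the complex \<open>X \<rightarrow> Y\<close> as a Yoneda complex of length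
  1, so that the general results on apexes and augmentations cover the comparison complex of a
  filtration.\<close>

lemma exact_seq_short:
  assumes m: "monic A m" "m \<in> Hom A X Y" and p: "is_cokernel A m p" "p \<in> Hom A Y Z"
  shows "exact_seq A 1 ((!) [p, m])"
proof -
  have "Dom A m = X" "Cod A p = Z" using m p by (simp_all add: Hom_def)
  then show ?thesis
    using exact_at_monic[OF m] exact_at_cokernel[OF p(1) m(2) p(2)] exact_at_epic_iff[OF p(2)]
      is_cokernel_epic[OF p(1)] by (simp add: exact_seq_def)
qed

section \<open>A filtration, with quotients given by the cokernels \<open>p1\<close>,
  \<open>p2\<close> and the induced arrow \<open>h\<close> between them\<close>

context
  fixes G F1 F2 Q1 Q2 i1 i2 j p1 p2 h
  assumes i1: "i1 \<in> Hom A F1 G" "monic A i1" and i2: "i2 \<in> Hom A F2 G" "monic A i2"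
    and j: "j \<in> Hom A F1 F2" "i2 \<cdot> j = i1"
    and p1: "p1 \<in> Hom A G Q1" "is_cokernel A i1 p1"
    and p2: "p2 \<in> Hom A G Q2" "is_cokernel A i2 p2"
    and h: "h \<in> Hom A Q1 Q2" "h \<cdot> p1 = p2"
begin

lemma filtration_exact_seq: "exact_seq A 2 ((!) [h, p1 \<cdot> i2, j])"
proof -
  let ?f = "p1 \<cdot> i2"
  note f = comp_Hom[OF i2(1) p1(1)]
  have C: "Cod A p1 = Q1" "Cod A p2 = Q2" using p1(1) p2(1) by (simp_all add: Hom_def)
  \<comment> \<open>\<open>i2 \<cdot> j\<close> is the monic \<open>i1\<close>, so its first factor
    is monic.\<close>
  have "monic A j"
    unfolding monic_def
  proof (intro conjI allI ballI impI)
    show "j \<in> arr A" using j(1) by (simp add: Hom_def)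
    fix W u v assume "u \<in> Hom A W (Dom A j)" "v \<in> Hom A W (Dom A j)" and eq: "j \<cdot> u = j \<cdot> v"
    then have uv: "u \<in> Hom A W F1" "v \<in> Hom A W F1" using j(1) by (simp_all add: Hom_def)
    show "u = v"
      using monic_cancel[OF i1(2,1) uv] comp_assoc[OF uv(1) j(1) i2(1)] comp_assoc[OF uv(2) j(1) i2(1)]
        eq j(2) by simp
  qed
  then have 1: "exact_at A (hzero A (zero_ob A) F1) j" using exact_at_monic j(1) by blast
  \<comment> \<open>If \<open>?f\<close> kills \<open>k\<close>, then \<open>p1\<close> kills
    \<open>i2 \<cdot> k\<close>, which therefore factors through \<open>i1 = i2 \<cdot> j\<close>.
    Cancelling \<open>i2\<close> shows that \<open>k\<close> factors through
    \<open>j\<close>.\<close>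
  have 2: "exact_at A j ?f"
    unfolding exact_at_iff[OF j(1) f]
  proof (intro conjI allI ballI impI)
    show "?f \<cdot> j = hzero A F1 Q1"
      using comp_assoc[OF j(1) i2(1) p1(1)] j(2) is_cokernelD(2)[OF p1(2) i1(1)] C by simp
    fix V W k t assume k: "k \<in> Hom A V F2" "?f \<cdot> k = hzero A V Q1"
      and t: "t \<in> Hom A F2 W" "t \<cdot> j = hzero A F1 W"
    have "p1 \<cdot> (i2 \<cdot> k) = hzero A V (Cod A p1)"
      using comp_assoc[OF k(1) i2(1) p1(1)] k(2) C by simp
    then obtain u where u: "u \<in> Hom A V F1" "i1 \<cdot> u = i2 \<cdot> k"
      using monic_kernel_of_cokernel[OF i1(2,1) p1(2) comp_Hom[OF k(1) i2(1)]] by blast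
    have "i2 \<cdot> (j \<cdot> u) = i2 \<cdot> k" using comp_assoc[OF u(1) j(1) i2(1)] j(2) u(2) by simp
    then have "j \<cdot> u = k" using monic_cancel[OF i2(2,1) comp_Hom[OF u(1) j(1)] k(1)] by simp
    then show "t \<cdot> k = hzero A V W"
      using comp_assoc[OF u(1) j(1) t(1)] t(2) comp_hzero_left[OF u(1)] Hom_obj[OF t(1)] by simp
  qed
  \<comment> \<open>If \<open>t\<close> kills \<open>?f\<close>, then \<open>t \<cdot> p1\<close>
    kills \<open>i2\<close> and factors through \<open>p2 = h \<cdot> p1\<close>. Cancelling
    \<open>p1\<close> shows that \<open>t\<close> factors through \<open>h\<close>.\<close>
  have 3: "exact_at A ?f h"
    unfolding exact_at_iff[OF f h(1)]
  proof (intro conjI allI ballI impI)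
    show "h \<cdot> ?f = hzero A F2 Q2"
      using comp_assoc[OF i2(1) p1(1) h(1)] h(2) is_cokernelD(2)[OF p2(2) i2(1)] C by simp
    fix V W k t assume k: "k \<in> Hom A V Q1" "h \<cdot> k = hzero A V Q2"
      and t: "t \<in> Hom A Q1 W" "t \<cdot> ?f = hzero A F2 W"
    have "(t \<cdot> p1) \<cdot> i2 = hzero A F2 W" using comp_assoc[OF i2(1) p1(1) t(1)] t(2) by simp
    then obtain v where v: "v \<in> Hom A Q2 W" "v \<cdot> p2 = t \<cdot> p1"
      using is_cokernel_factor[OF p2(2) i2(1) comp_Hom[OF p1(1) t(1)]] C by auto
    have "(v \<cdot> h) \<cdot> p1 = t \<cdot> p1" using comp_assoc[OF p1(1) h(1) v(1)] h(2) v(2) by simp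
    then have "v \<cdot> h = t"
      using epic_cancel[OF is_cokernel_epic[OF p1(2)] p1(1) comp_Hom[OF h(1) v(1)] t(1)] by simp
    then show "t \<cdot> k = hzero A V W"
      using comp_assoc[OF k(1) h(1) v(1)] k(2) comp_hzero_right[OF v(1)] Hom_obj[OF k(1)] by simp
  qed
  \<comment> \<open>\<open>h \<cdot> p1\<close> is the epic \<open>p2\<close>, so its last factor is
    epic.\<close>
  have "epic A h"
    unfolding epic_def
  proof (intro conjI allI ballI impI)
    show "h \<in> arr A" using h(1) by (simp add: Hom_def)
    fix W u v assume "u \<in> Hom A (Cod A h) W" "v \<in> Hom A (Cod A h) W" and eq: "u \<cdot> h = v \<cdot> h"
    then have uv: "u \<in> Hom A Q2 W" "v \<in> Hom A Q2 W" using h(1) by (simp_all add: Hom_def)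
    show "u = v"
      using epic_cancel[OF is_cokernel_epic[OF p2(2)] p2(1) uv] comp_assoc[OF p1(1) h(1) uv(1)]
        comp_assoc[OF p1(1) h(1) uv(2)] eq h(2) by simp
  qed
  then have 4: "exact_at A h (hzero A Q2 (zero_ob A))" using exact_at_epic_iff[OF h(1)] by simp
  have "Dom A j = F1" "Cod A h = Q2" using j(1) h(1) by (simp_all add: Hom_def)
  then show ?thesis
    using 1 2 3 4 by (simp add: exact_seq_def numeral_2_eq_2 All_less_Suc)
qed

lemma filtration_yoneda_class:
  "yoneda_class A 2 ((!) [h, p1 \<cdot> i2, j]) = Ext_zero A 2 Q2 F1"
proof -
  let ?e = "(!) [h, p1 \<cdot> i2, j]" and ?e' = "(!) [p2, i2]"
  let ?L = "yoneda_complex A 2 ?e" and ?M = "yoneda_complex A 1 ?e'"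
  note f = comp_Hom[OF i2(1) p1(1)]
  have dc: "Dom A h = Q1" "Cod A h = Q2" "Dom A (p1 \<cdot> i2) = F2" "Dom A j = F1"
    "Dom A p2 = G" "Cod A p2 = Q2" "Dom A i2 = F2"
    using h j i2 p2 f by (simp_all add: Hom_def)
  have F2: "F2 \<in> obj A" using Hom_obj[OF i2(1)] by blast
  have e: "exact_seq A 2 ?e" by (rule filtration_exact_seq)
  have e': "exact_seq A 1 ?e'" by (rule exact_seq_short[OF i2(2,1) p2(2,1)])
  note L = is_complex_yoneda[OF e] and M = is_complex_yoneda[OF e']
  \<comment> \<open>The projection in degree 0, the identity of \<open>F2\<close> in degree -1, and
    zero elsewhere. In degree -2 the source \<open>?M\<close> is zero while \<open>?L\<close> is
    \<open>F1\<close>.\<close>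
  define t where "t n = (if n = 0 then p1 else if n = - 1 then ident A F2
    else hzero A (ob ?M n) (ob ?L n))" for n
  have obs: "ob ?L 0 = Q1" "ob ?L (- 1) = F2" "ob ?M 0 = G" "ob ?M (- 1) = F2"
    by (simp_all add: yoneda_complex_simps dc)
  have ds: "diff ?L (- 1) = p1 \<cdot> i2" "diff ?M (- 1) = i2"
    by (simp_all add: yoneda_complex_simps)
  have tH: "t n \<in> Hom A (ob ?M n) (ob ?L n)" for n
    using p1(1) ident_Hom[OF F2] hzero_Hom[OF yoneda_ob[OF e'] yoneda_ob[OF e], of n n] obs
    by (auto simp: t_def)
  have t: "chain_map A ?M ?L t"
    unfolding chain_map_def
  proof (intro conjI allI)
    fix n
    show "t n \<in> Hom A (ob ?M n) (ob ?L n)" by (rule tH)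
    show "t (n + 1) \<cdot> diff ?M n = diff ?L n \<cdot> t n"
    proof (cases "n = - 1")
      case True
      show ?thesis using comp_ident_right[OF f] unfolding True ds by (simp add: ds t_def)
    next
      \<comment> \<open>Outside degree -1 the differential of \<open>?M\<close> is zero. On the
        other side, \<open>t n\<close> is zero as well unless \<open>n = 0\<close>, and there the
        outgoing differential of \<open>?L\<close> is zero.\<close>
      case False
      have "diff ?M n = hzero A (ob ?M n) (ob ?M (n + 1))"
        using False by (subst yoneda_complex_simps(2)) auto
      then have "t (n + 1) \<cdot> diff ?M n = hzero A (ob ?M n) (ob ?L (n + 1))"
        using comp_hzero_right[OF tH yoneda_ob[OF e']] by simp
      also have "\<dots> = diff ?L n \<cdot> t n"
      proof (cases "n = 0")
        case True
        have "diff ?L 0 = hzero A (ob ?L 0) (ob ?L (0 + 1))"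
          by (subst yoneda_complex_simps(2)) simp
        then show ?thesis using True comp_hzero_left[OF tH yoneda_ob[OF e], of 0 "0 + 1"] by simp
      next
        case n0: False
        have "t n = hzero A (ob ?M n) (ob ?L n)" using n0 False by (simp add: t_def)
        then show ?thesis using comp_hzero_right[OF yoneda_diff[OF e] yoneda_ob[OF e']] by simp
      qed
      finally show ?thesis .
    qed
  qed
  have C: "Cod A (?e 0) = Q2" "Cod A (?e' 0) = Q2" and B: "Dom A (?e 2) = F1"
    by (simp_all add: dc)
  have Q2: "Q2 \<in> obj A" and F1: "F1 \<in> obj A" using Hom_obj h(1) j(1) by blast+
  \<comment> \<open>In degree 0 this is \<open>h \<cdot> p1 = p2\<close>: the refined left leg is
    the augmentation of the short exact sequence, already known to be a quasi-isomorphism.\<close>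
  have "(\<lambda>n. yoneda_s A 2 ?e n \<cdot> t n) = yoneda_s A 1 ?e'"
  proof
    fix n
    show "yoneda_s A 2 ?e n \<cdot> t n = yoneda_s A 1 ?e' n"
    proof (cases "n = 0")
      case True
      then show ?thesis using h(2) by (simp add: yoneda_s_def t_def)
    next
      case False
      then show ?thesis
        unfolding yoneda_s_def C using comp_hzero_left[OF tH stalk_obj[OF Q2]] by simp
    qed
  qed
  then have st: "quasi_iso A ?M (stalk A (Cod A (?e 0))) (\<lambda>n. yoneda_s A 2 ?e n \<cdot> t n)"
    using quasi_iso_yoneda_s[OF e'] unfolding C by simp
  have gt: "yoneda_g A 2 ?e n \<cdot> t n =
      hzero A (ob ?M n) (ob (shift A (int 2) (stalk A (Dom A (?e 2)))) n)" for n
  \<comment> \<open>In degree -2 the right leg is an identity but \<open>t\<close> vanishes; in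
    every other degree the right leg vanishes.\<close>
  proof (cases "n = - 2")
    case True
    have g: "yoneda_g A 2 ?e n \<in> Hom A (ob ?L n) (ob (shift A (int 2) (stalk A (Dom A (?e 2)))) n)"
      by (rule chain_mapD(1)[OF chain_map_yoneda_g[OF e]])
    have "t n = hzero A (ob ?M n) (ob ?L n)" using True by (simp add: t_def)
    then show ?thesis using comp_hzero_right[OF g yoneda_ob[OF e']] by simp
  next
    case False
    have "ob (shift A (int 2) (stalk A (Dom A (?e 2)))) n \<in> obj A"
      unfolding B shift_ob by (rule stalk_obj[OF F1])
    then show ?thesis
      using False comp_hzero_left[OF tH] by (simp add: yoneda_g_def)
  qed
  show ?thesis
    using yoneda_class_zero[OF e M t st gt] unfolding C B .
qed

end

end

text \<open>Quotients are determined up to isomorphism, so \<open>Q1\<close> and \<open>Q2\<close>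
  are arbitrary targets of cokernels of the inclusions. Lists are indexed from the right end of the
  sequence: \<open>h\<close> has index 0 and \<open>j\<close> index 2. Exactness and membership in
  \<open>Ext\<close> are concluded together with the vanishing, so that \<alpha> is the class of a
  genuine exact sequence.\<close>

theorem lemma2:
  fixes A :: "('o, 'm, 'c) precat_scheme"
    and G F1 F2 Q1 Q2 :: 'o
    and i1 i2 j p1 p2 h f :: 'm
    and \<alpha> :: "('o, 'm) darrow"
  assumes "abelian_category A"
    and "i1 \<in> Hom A F1 G" and "monic A i1"
    and "i2 \<in> Hom A F2 G" and "monic A i2"
    and "j \<in> Hom A F1 F2" and "i2 \<cdot>\<^bsub>A\<^esub> j = i1"
    and "p1 \<in> Hom A G Q1" and "is_cokernel A i1 p1"
    and "p2 \<in> Hom A G Q2" and "is_cokernel A i2 p2"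
    and "h \<in> Hom A Q1 Q2" and "h \<cdot>\<^bsub>A\<^esub> p1 = p2"
    and "f = p1 \<cdot>\<^bsub>A\<^esub> i2"
    and "\<alpha> = yoneda_class A 2 ((!) [h, f, j])"
  shows "exact_seq A 2 ((!) [h, f, j]) \<and> \<alpha> \<in> Ext A 2 Q2 F1 \<and> \<alpha> = Ext_zero A 2 Q2 F1"
proof -
  interpret abelian_category A by (rule assms(1))
  note e = filtration_exact_seq[OF assms(2-13), folded assms(14)]
  have "Cod A h = Q2" "Dom A j = F1" using assms(6,12) by (simp_all add: Hom_def)
  then have "\<alpha> \<in> Ext A 2 Q2 F1" using yoneda_class_Ext[OF e] assms(15) by simp
  then show ?thesis
    using e filtration_yoneda_class[OF assms(2-13), folded assms(14)] assms(15) by simp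
qed

end
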